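(* Let $(\mu_k)_{k\in\mathbb N}$ be an equipartition-consistent random graph model, with $\mu_k$ a probability measure on $\Delta^{k\times k}$. Then there exists a unique random exchangeable probability measure $\mathsf M$ on $[0,1]^2$ such that $\mathrm{Law}(\mathsf G_k[\mathsf M])=\mu_k$ for all $k\in\mathbb N$.
   Context: $\Delta^{k\times k}$: $k\times k$ nonnegative matrices with entries summing to $1$. For $f:[m]\to[k]$ and $G\in\mathbb R^{m\times m}$, $(\rho(f)G)_{i,j}=\sum_{v\in f^{-1}(i),u\in f^{-1}(j)}G_{v,u}$. An equipartition is a map $d:[nk]\to[k]$ all of whose fibers have size $n$. A sequence of probability measures $(\mu_k)$ on $\Delta^{k\times k}$ is an equipartition-consistent random graph model if for all $k,n\in\mathbb N$ and every equipartition $d:[nk]\to[k]$, $X\sim\mu_{nk}$ implies $\rho(d)X\sim\mu_k$. A random probability measure $\mathsf M$ on $[0,1]^2$ is exchangeable if $\mathsf M$ and its pushforward under $(x,y)\mapsto(\sigma(x),\sigma(y))$ are equal in distribution for every Lebesgue-measure-preserving bijection $\sigma:[0,1]\to[0,1]$. $\mathsf G_k[\mathsf M]$ is the random $k\times k$ matrix with entries $\mathsf M(I_i^{(k)}\times I_j^{(k)})$, $I_i^{(k)}=[(i-1)/k,i/k)$. *)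

theory Defs
  imports "HOL-Probability.Probability"
begin

text \<open>Index set of a k x k matrix (0-based indices, i.e. [k] = {0,...,k-1}).\<close>
definition grid :: "nat \<Rightarrow> (nat \<times> nat) set" where
  "grid k = {..<k} \<times> {..<k}"

definition MatSpace :: "nat \<Rightarrow> (nat \<times> nat \<Rightarrow> real) measure" where
  "MatSpace k = PiM (grid k) (\<lambda>_. borel)"

definition Delta :: "nat \<Rightarrow> (nat \<times> nat \<Rightarrow> real) set" where
  "Delta k = {G \<in> space (MatSpace k). (\<forall>p\<in>grid k. 0 \<le> G p) \<and> (\<Sum>p\<in>grid k. G p) = 1}"

definition prob_on_Delta :: "nat \<Rightarrow> (nat \<times> nat \<Rightarrow> real) measure \<Rightarrow> bool" where
  "prob_on_Delta k P \<longleftrightarrow> prob_space P \<and> sets P = sets (MatSpace k) \<and> emeasure P (Delta k) = 1"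

definition rho :: "nat \<Rightarrow> nat \<Rightarrow> (nat \<Rightarrow> nat) \<Rightarrow> (nat \<times> nat \<Rightarrow> real) \<Rightarrow> (nat \<times> nat \<Rightarrow> real)" where
  "rho m k f G = (\<lambda>p\<in>grid k.
     (\<Sum>v\<in>{v\<in>{..<m}. f v = fst p}. \<Sum>u\<in>{u\<in>{..<m}. f u = snd p}. G (v, u)))"

definition equipartition :: "nat \<Rightarrow> nat \<Rightarrow> (nat \<Rightarrow> nat) \<Rightarrow> bool" where
  "equipartition n k d \<longleftrightarrow> d \<in> {..<n*k} \<rightarrow> {..<k} \<and>
     (\<forall>i<k. card {v\<in>{..<n*k}. d v = i} = n)"

text \<open>Equipartition-consistent random graph model (indices k \<ge> 1; mu 0 is irrelevant).\<close>
definition equipartition_consistent :: "(nat \<Rightarrow> (nat \<times> nat \<Rightarrow> real) measure) \<Rightarrow> bool" where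
  "equipartition_consistent \<mu> \<longleftrightarrow>
     (\<forall>k\<ge>1. prob_on_Delta k (\<mu> k)) \<and>
     (\<forall>k\<ge>1. \<forall>n\<ge>1. \<forall>d. equipartition n k d \<longrightarrow>
        distr (\<mu> (n*k)) (MatSpace k) (rho (n*k) k d) = \<mu> k)"

definition Sq :: "(real \<times> real) measure" where
  "Sq = restrict_space borel ({0..1} \<times> {0..1})"

definition Leb01 :: "real measure" where
  "Leb01 = restrict_space lborel {0..1}"

definition mp_bij :: "(real \<Rightarrow> real) \<Rightarrow> bool" where
  "mp_bij \<sigma> \<longleftrightarrow> bij_betw \<sigma> {0..1} {0..1} \<and> \<sigma> \<in> measurable Leb01 Leb01 \<and>
     distr Leb01 Leb01 \<sigma> = Leb01"

text \<open>A random probability measure on [0,1]^2 is described by its law, a probability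
  measure on the Giry space of probability measures on [0,1]^2.  It is exchangeable iff its
  law is invariant under pushing forward by (x,y) |-> (sigma x, sigma y).\<close>
definition exchangeable_law :: "(real \<times> real) measure measure \<Rightarrow> bool" where
  "exchangeable_law P \<longleftrightarrow>
     (\<forall>\<sigma>. mp_bij \<sigma> \<longrightarrow>
        distr P (prob_algebra Sq) (\<lambda>m. distr m Sq (\<lambda>(x, y). (\<sigma> x, \<sigma> y))) = P)"

text \<open>Interval I_i^{(k)} = [(i-1)/k, i/k), written 0-based as [i/k, (i+1)/k).\<close>
definition Ik :: "nat \<Rightarrow> nat \<Rightarrow> real set" where
  "Ik k i = {real i / real k ..< (real i + 1) / real k}"

definition Gk :: "nat \<Rightarrow> (real \<times> real) measure \<Rightarrow> (nat \<times> nat \<Rightarrow> real)" where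
  "Gk k M = (\<lambda>p\<in>grid k. measure M (Ik k (fst p) \<times> Ik k (snd p)))"

end

theory Submission
  imports Defs
begin

text \<open>
  Existence: consistency along the block maps between the levels \<open>n!\<close> and Kolmogorov's extension theorem
  give a random consistent family of matrices.  By exchangeability every row and column carries expected
  mass \<open>1/k\<close>, so almost surely no mass escapes to the grid lines and the family is the family of cell
  masses of a measure, itself obtained from Kolmogorov's theorem as the law of the limit of the nested
  lower left cell corners.

  Exchangeability: the expected margins of the random measure are Lebesgue measure.  Hence the preimages of
  the intervals under a measure preserving map, being approximable by unions of cells forming an
  equipartition, give a random matrix that is a limit in probability of matrices with law \<open>\<mu> k\<close>.

  Uniqueness: the cell masses at all levels \<open>n!\<close> determine a measure concentrated on \<open>[0,1)\<^sup>2\<close>, and the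
  levels are directed, so the laws of the matrices determine the law of the measure.
\<close>

text \<open>Divisibility only directs the levels. The factorials are a cofinal chain in it, so the
  extension can run along a sequence, and one level resolves any finite set of rational endpoints.
  The obstacle is that cells are half-open while nested lower left corners converge only into closed
  cells. Unit mass on the last cell of every level, for instance, is a consistent family that
  belongs to no measure on \<open>[0,1)^2\<close>. What excludes this is a mean value:
  transpositions of labels are equipartitions with fibres of size one, so rows are exchangeable, and
  the rows of level \<open>m!\<close> that are last inside a row of level \<open>n!\<close> carry
  mean mass \<open>n!/m!\<close>, which tends to 0. The margins of a single realisation may be far
  from uniform, so an error made on a small set of coordinates is not small for each realisation. It
  moves the mass of a rectangle by at most the mass of two strips over that set, and only the mean
  of this is controlled. Markov's inequality then yields closeness in probability, which suffices
  because the approximating matrices all have exactly the law \<open>\<mu> k\<close>.\<close>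

section \<open>Inverse limits of Polish probability spaces along a sequence\<close>

text \<open>Kolmogorov's theorem wants a law on every finite index set \<open>J\<close>. Along a
  chain it is the image of the law at the largest index of \<open>J\<close>, since that coordinate
  determines all the others. The relations between coordinates are recovered from the two-point
  laws, almost surely and simultaneously because there are countably many.\<close>

lemma inverse_limit_exists:
  fixes \<nu> :: "nat \<Rightarrow> 'a::polish_space measure" and f :: "nat \<Rightarrow> nat \<Rightarrow> 'a \<Rightarrow> 'a"
  assumes prob: "\<And>n. prob_space (\<nu> n)" and sets_\<nu>: "\<And>n. sets (\<nu> n) = sets borel"
    and f: "\<And>n m. n \<le> m \<Longrightarrow> f n m \<in> borel_measurable borel"
    and f_comp: "\<And>n m k x. n \<le> m \<Longrightarrow> m \<le> k \<Longrightarrow> f n m (f m k x) = f n k x"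
    and distr_f: "\<And>n m. n \<le> m \<Longrightarrow> distr (\<nu> m) borel (f n m) = \<nu> n"
  shows "\<exists>L. prob_space L \<and> sets L = sets (PiM UNIV (\<lambda>_. borel)) \<and>
    (\<forall>n. distr L borel (\<lambda>x. x n) = \<nu> n) \<and> (AE x in L. \<forall>n m. n \<le> m \<longrightarrow> x n = f n m (x m))"
proof -
  \<comment> \<open>Inserting 0 keeps \<open>Max\<close> meaningful for
    \<open>J = {}\<close>.\<close>
  define top where "top J = Max (insert 0 J)" for J :: "nat set"
  have le_top: "n \<le> top J" if "finite J" "n \<in> J" for n J
    using that by (simp add: top_def)
  have top_mono: "top J \<le> top H" if "finite H" "J \<subseteq> H" for J H
    unfolding top_def using that by (intro Max_mono) auto
  define P where "P J = distr (\<nu> (top J)) (PiM J (\<lambda>_. borel)) (\<lambda>x. \<lambda>n\<in>J. f n (top J) x)" for J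
  have meas: "(\<lambda>x. \<lambda>n\<in>J. f n m x) \<in> measurable borel (PiM J (\<lambda>_. borel))"
    if "\<And>n. n \<in> J \<Longrightarrow> n \<le> m" for J m
    using that by (intro measurable_restrict f) auto
  have meas\<nu>: "(\<lambda>x. \<lambda>n\<in>J. f n m x) \<in> measurable (\<nu> k) (PiM J (\<lambda>_. borel))"
    if "\<And>n. n \<in> J \<Longrightarrow> n \<le> m" for J m k
    using meas[OF that] by (simp cong: measurable_cong_sets add: sets_\<nu>)
  have "projective_family UNIV P (\<lambda>_. borel)"
  proof (rule projective_family.intro)
    fix J H :: "nat set" assume JH: "J \<subseteq> H" "finite H"
    then have J: "finite J" by (auto intro: finite_subset)
    have "P J = distr (distr (\<nu> (top H)) borel (f (top J) (top H))) (PiM J (\<lambda>_. borel))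
        (\<lambda>x. \<lambda>n\<in>J. f n (top J) x)"
      unfolding P_def by (simp add: distr_f top_mono JH)
    also have "\<dots> = distr (\<nu> (top H)) (PiM J (\<lambda>_. borel))
        ((\<lambda>x. \<lambda>n\<in>J. f n (top J) x) \<circ> f (top J) (top H))"
      using f[OF top_mono[of H J]] JH
      by (intro distr_distr meas le_top J) (auto cong: measurable_cong_sets simp: sets_\<nu>)
    also have "\<dots> = distr (\<nu> (top H)) (PiM J (\<lambda>_. borel))
        ((\<lambda>g. restrict g J) \<circ> (\<lambda>x. \<lambda>n\<in>H. f n (top H) x))"
      using JH by (intro distr_cong refl)
        (auto simp: fun_eq_iff restrict_def f_comp le_top J top_mono)
    also have "\<dots> = distr (P H) (PiM J (\<lambda>_. borel)) (\<lambda>g. restrict g J)"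
      unfolding P_def using JH
      by (intro distr_distr[symmetric] measurable_restrict_subset meas\<nu> le_top) auto
    finally show "P J = distr (P H) (PiM J (\<lambda>_. borel)) (\<lambda>g. restrict g J)" .
  next
    fix J :: "nat set" assume "finite J"
    then show "prob_space (P J)"
      unfolding P_def by (intro prob_space.prob_space_distr prob meas\<nu> le_top)
  qed
  then interpret pp: polish_projective UNIV P
    by (rule polish_projective.intro)
  have lim_PJ: "distr pp.lim (PiM J (\<lambda>_. borel)) (\<lambda>g. restrict g J) = P J" if J: "finite J" for J
  proof (rule measure_eqI)
    fix A assume "A \<in> sets (distr pp.lim (PiM J (\<lambda>_. borel)) (\<lambda>g. restrict g J))"
    then have A: "A \<in> sets (PiM J (\<lambda>_. borel))" by simp
    have "emeasure (distr pp.lim (PiM J (\<lambda>_. borel)) (\<lambda>g. restrict g J)) A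
        = emeasure pp.lim (prod_emb UNIV (\<lambda>_. borel) J A)"
      by (subst emeasure_distr[OF _ A])
        (auto simp: measurable_cong_sets[OF pp.sets_lim refl] measurable_restrict_subset
           prod_emb_def space_PiM)
    also have "\<dots> = P J A" by (rule pp.emeasure_lim_emb) (use J A in auto)
    finally show "emeasure (distr pp.lim (PiM J (\<lambda>_. borel)) (\<lambda>g. restrict g J)) A = emeasure (P J) A" .
  qed (simp add: P_def)
  have restrict_lim: "(\<lambda>g. restrict g J) \<in> measurable pp.lim (PiM J (\<lambda>_. borel))" for J
    by (auto simp: measurable_cong_sets[OF pp.sets_lim refl] measurable_restrict_subset)
  have distr_nth: "distr pp.lim borel (\<lambda>x. x n) = \<nu> n" for n
  proof -
    have "distr pp.lim borel (\<lambda>x. x n) = distr (distr pp.lim (PiM {n} (\<lambda>_. borel)) (\<lambda>g. restrict g {n})) borel (\<lambda>x. x n)"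
      by (subst distr_distr) (auto simp: restrict_lim comp_def)
    also have "\<dots> = distr (P {n}) borel (\<lambda>x. x n)" by (simp add: lim_PJ)
    also have "\<dots> = distr (\<nu> n) borel (f n n)"
      unfolding P_def by (subst distr_distr) (auto simp: top_def comp_def intro!: meas\<nu>)
    finally show ?thesis by (simp add: distr_f)
  qed
  have AE: "AE x in pp.lim. x n = f n m (x m)" if nm: "n \<le> m" for n m
  proof -
    let ?J = "{n, m}"
    have [simp]: "top ?J = m" using nm by (auto simp: top_def)
    have [measurable]: "f n m \<in> borel_measurable borel" using f nm by auto
    \<comment> \<open>Under \<open>P ?J\<close> the pair is \<open>(f n m y, f m m y)\<close> with
      \<open>y\<close> drawn from \<open>\<nu> m\<close>. No identity \<open>f m m y = y\<close> is
      available, but \<open>f_comp\<close> gives \<open>f n m (f m m y) = f n m y\<close>.\<close>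
    have "AE x in P ?J. x n = f n m (x m)"
      unfolding P_def by (subst AE_distr_iff) (use nm in \<open>auto intro!: meas\<nu> simp: f_comp\<close>)
    then have "AE x in distr pp.lim (PiM ?J (\<lambda>_. borel)) (\<lambda>g. restrict g ?J). x n = f n m (x m)"
      by (subst lim_PJ) simp_all
    then show ?thesis
      by (subst (asm) AE_distr_iff) (auto simp: restrict_lim)
  qed
  then have "AE x in pp.lim. \<forall>n m. n \<le> m \<longrightarrow> x n = f n m (x m)"
    by (simp add: AE_all_countable)
  then show ?thesis
    using distr_nth by (intro exI[of _ pp.lim]) (simp add: pp.P.prob_space_axioms)
qed

subsection \<open>Grid cells\<close>

lemma Ik_iff_floor: "0 < k \<Longrightarrow> x \<in> Ik k i \<longleftrightarrow> \<lfloor>x * real k\<rfloor> = int i"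
  by (auto simp: Ik_def floor_eq_iff field_simps)

lemma Ik_subset_unit: "i < k \<Longrightarrow> Ik k i \<subseteq> {0..<1}"
proof
  fix x assume *: "i < k" "x \<in> Ik k i"
  then have "real i + 1 \<le> real k" by linarith
  then have "(real i + 1) / real k \<le> 1" using * by (simp add: field_simps)
  moreover have "0 \<le> real i / real k" by simp
  ultimately show "x \<in> {0..<1}" using * unfolding Ik_def atLeastLessThan_iff
    by (meson order_trans less_le_trans)
qed

lemma disjoint_Ik: "0 < k \<Longrightarrow> i \<noteq> j \<Longrightarrow> Ik k i \<inter> Ik k j = {}"
  by (auto simp: Ik_iff_floor)

text \<open>With cell membership read as a floor, the coarse index of a point is its fine index
  \<open>div q\<close>. The union of subcells is thus a statement about integer division.\<close>

lemma Ik_refine: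
  assumes "0 < q" "0 < k" "i < k"
  shows "(\<Union>v\<in>{v\<in>{..<q*k}. v div q = i}. Ik (q*k) v) = Ik k i"
proof (intro set_eqI)
  fix x :: real
  have eq: "\<lfloor>x * real k\<rfloor> = \<lfloor>x * real (q*k)\<rfloor> div int q"
    using floor_divide_real_eq_div[of "int q" "x * real (q*k)"] assms by (simp add: field_simps)
  have "(\<exists>v<q*k. v div q = i \<and> \<lfloor>x * real (q*k)\<rfloor> = int v) \<longleftrightarrow> \<lfloor>x * real k\<rfloor> = int i"
  proof safe
    fix v assume "\<lfloor>x * real (q*k)\<rfloor> = int v" "i = v div q"
    then show "\<lfloor>x * real k\<rfloor> = int (v div q)" unfolding eq by (simp add: zdiv_int)
  next
    assume *: "\<lfloor>x * real k\<rfloor> = int i"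
    define v where "v = nat \<lfloor>x * real (q*k)\<rfloor>"
    have "0 \<le> x * real k" using * by linarith
    then have "0 \<le> x" using assms by (simp add: zero_le_mult_iff)
    then have v: "\<lfloor>x * real (q*k)\<rfloor> = int v" by (simp add: v_def)
    then have "v div q = i" using * unfolding eq by (simp flip: zdiv_int)
    moreover from this have "v < q * k"
      using assms by (metis div_less_iff_less_mult mult.commute)
    ultimately show "\<exists>v<q*k. v div q = i \<and> \<lfloor>x * real (q*k)\<rfloor> = int v" using v by auto
  qed
  then show "x \<in> (\<Union>v\<in>{v\<in>{..<q*k}. v div q = i}. Ik (q*k) v) \<longleftrightarrow> x \<in> Ik k i"
    using assms by (auto simp: Ik_iff_floor)
qed

lemma space_Sq: "space Sq = {0..1} \<times> {0..1}"
  by (simp add: Sq_def space_restrict_space)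

lemma Times_in_sets_Sq:
  assumes "A \<in> sets borel" "B \<in> sets borel" "A \<subseteq> {0..1}" "B \<subseteq> {0..1}"
  shows "A \<times> B \<in> sets Sq"
proof -
  have "A \<times> B \<in> sets (borel \<Otimes>\<^sub>M borel)" using assms by auto
  then have "A \<times> B \<in> sets borel" by (simp only: borel_prod)
  moreover have "{0..1} \<times> {0..1} \<in> sets (borel :: (real\<times>real) measure)"
    by (intro borel_closed closed_Times) auto
  ultimately show ?thesis
    using assms unfolding Sq_def by (subst sets_restrict_space_iff) auto
qed

lemma Ik_borel [measurable]: "Ik k i \<in> sets borel"
  by (simp add: Ik_def)

lemma Ik_Times_sets: "i < k \<Longrightarrow> j < k \<Longrightarrow> Ik k i \<times> Ik k j \<in> sets Sq"
  using Ik_subset_unit[of i k] Ik_subset_unit[of j k] by (intro Times_in_sets_Sq) force+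

lemma measure_Union_cells:
  assumes M: "prob_space M" "sets M = sets Sq" and "S \<subseteq> {..<m}" "T \<subseteq> {..<m}"
  shows "measure M ((\<Union>v\<in>S. Ik m v) \<times> (\<Union>u\<in>T. Ik m u)) = (\<Sum>v\<in>S. \<Sum>u\<in>T. measure M (Ik m v \<times> Ik m u))"
proof (cases "m = 0")
  case False
  interpret prob_space M by fact
  have fin: "finite S" "finite T" using assms finite_subset by blast+
  have "(\<Union>v\<in>S. Ik m v) \<times> (\<Union>u\<in>T. Ik m u) = (\<Union>p\<in>S\<times>T. Ik m (fst p) \<times> Ik m (snd p))" by auto
  also have "measure M \<dots> = (\<Sum>p\<in>S\<times>T. measure M (Ik m (fst p) \<times> Ik m (snd p)))"
  proof (rule finite_measure_finite_Union)
    show "(\<lambda>p. Ik m (fst p) \<times> Ik m (snd p)) ` (S \<times> T) \<subseteq> sets M"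
      using assms by (auto intro!: Ik_Times_sets)
    show "disjoint_family_on (\<lambda>p. Ik m (fst p) \<times> Ik m (snd p)) (S \<times> T)"
      using disjoint_Ik[of m] False unfolding disjoint_family_on_def by fastforce
  qed (use fin in auto)
  also have "\<dots> = (\<Sum>v\<in>S. \<Sum>u\<in>T. measure M (Ik m v \<times> Ik m u))"
    by (simp add: sum.cartesian_product case_prod_beta)
  finally show ?thesis .
qed (use assms in auto)

text \<open>Merging labels of a cell matrix amounts to measuring rectangles whose sides are unions
  of cells. This holds for any \<open>f\<close>, so it serves both the block maps and the
  equipartitions that imitate a measurable partition.\<close>

lemma rho_Gk:
  assumes M: "prob_space M" "sets M = sets Sq" and "p \<in> grid k"
  shows "rho m k f (Gk m M) p =
    measure M ((\<Union>v\<in>{v\<in>{..<m}. f v = fst p}. Ik m v) \<times> (\<Union>u\<in>{u\<in>{..<m}. f u = snd p}. Ik m u))"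
  using assms(3) by (subst measure_Union_cells[OF M]) (auto simp: rho_def Gk_def grid_def)

lemma rho_Gk_coarsen:
  assumes M: "prob_space M" "sets M = sets Sq" and "0 < q" "0 < k"
  shows "rho (q*k) k (\<lambda>v. v div q) (Gk (q*k) M) = Gk k M"
proof
  fix p show "rho (q*k) k (\<lambda>v. v div q) (Gk (q*k) M) p = Gk k M p"
  proof (cases "p \<in> grid k")
    case True
    then have "fst p < k" "snd p < k" by (auto simp: grid_def)
    then show ?thesis
      using True assms by (subst rho_Gk[OF M True]) (simp only: Ik_refine Gk_def restrict_apply if_True)
  next
    case False
    then show ?thesis by (simp add: rho_def Gk_def)
  qed
qed

lemma measurable_Gk [measurable]: "Gk k \<in> measurable (prob_algebra Sq) (MatSpace k)"
  unfolding Gk_def[abs_def] MatSpace_def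
  by (intro measurable_restrict measurable_measure_prob_algebra Ik_Times_sets) (auto simp: grid_def)

lemma measurable_rho [measurable]:
  "rho m k f \<in> measurable (MatSpace m) (MatSpace k)"
  unfolding rho_def[abs_def] MatSpace_def
  by (intro measurable_restrict borel_measurable_sum measurable_component_singleton)
    (auto simp: grid_def)

section \<open>Borel sets of the square and measurability through cell masses\<close>

text \<open>Rational corners are chosen so that every generator can be resolved by the cells of some
  factorial level. Both coordinates are measurable for the generated \<sigma>-algebra, hence so is
  the identity into \<open>Sq\<close>.\<close>

lemma sets_Sq_eq:
  "sets Sq = sigma_sets ({0..1}\<times>{0..1})
     {({0..1}\<inter>{..<a}) \<times> ({0..1}\<inter>{..<b}) | a b. a \<in> \<rat> \<and> b \<in> \<rat>}" (is "_ = sigma_sets ?S ?G")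
proof (rule antisym)
  have G: "?G \<subseteq> Pow ?S" by auto
  let ?N = "sigma ?S ?G"
  have less: "{w \<in> space ?N. g w < a} \<in> sets ?N" if
    g: "\<And>r. r \<in> \<rat> \<Longrightarrow> {w \<in> ?S. g w < r} \<in> ?G" for a and g :: "real\<times>real \<Rightarrow> real"
  proof -
    have "{w \<in> ?S. g w < a} = (\<Union>r\<in>{r\<in>\<rat>. r < a}. {w \<in> ?S. g w < r})"
      using Rats_dense_in_real by (auto intro: less_trans) (metis Rats_dense_in_real)+
    also have "\<dots> \<in> sigma_sets ?S ?G"
      using countable_subset[OF _ countable_rat, of "{r\<in>\<rat>. r < a}"] g
      by (intro sigma_sets_UNION) auto
    finally show ?thesis using G by simp
  qed
  have "{w \<in> ?S. fst w < r} \<in> ?G" if "r \<in> \<rat>" for r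
    \<comment> \<open>The bound 2 exceeds the whole unit interval, so the second side is all of
      \<open>{0..1}\<close>.\<close>
    using that by (intro CollectI exI[of _ r] exI[of _ 2]) auto
  then have 1: "fst \<in> borel_measurable ?N"
    unfolding borel_measurable_iff_less by (intro allI less)
  have "{w \<in> ?S. snd w < r} \<in> ?G" if "r \<in> \<rat>" for r
    using that by (intro CollectI exI[of _ 2] exI[of _ r]) auto
  then have 2: "snd \<in> borel_measurable ?N"
    unfolding borel_measurable_iff_less by (intro allI less)
  have "(\<lambda>w. (fst w, snd w)) \<in> measurable ?N (borel \<Otimes>\<^sub>M borel)"
    using 1 2 by (rule measurable_Pair)
  then have "(\<lambda>w. w) \<in> measurable ?N Sq"
    unfolding Sq_def borel_prod by (intro measurable_restrict_space2) (auto simp: space_measure_of_conv)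
  then have "(\<lambda>w. w) -` A \<inter> space ?N \<in> sets ?N" if "A \<in> sets Sq" for A
    using that by (rule measurable_sets)
  then show "sets Sq \<subseteq> sigma_sets ?S ?G"
    using G sets.sets_into_space[of _ Sq] by (auto simp: space_Sq Int_absorb2)
  have "?G \<subseteq> sets Sq" by (auto intro!: Times_in_sets_Sq)
  then show "sigma_sets ?S ?G \<subseteq> sets Sq"
    using sets.sigma_sets_subset[of ?G Sq] by (simp add: space_Sq)
qed

lemma Rats_common_fact_denominator:
  fixes a b :: real
  assumes "a \<in> \<rat>" "b \<in> \<rat>"
  shows "\<exists>n. a * fact n \<in> \<int> \<and> b * fact n \<in> \<int>"
proof -
  have *: "\<exists>n0>0. \<forall>n\<ge>n0. a * fact n \<in> (\<int>::real set)" if a: "a \<in> \<rat>" for a :: real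
  proof -
    obtain p q where q: "q > 0" "a = of_int p / of_int q" using a Rats_cases' by metis
    have "a * fact n \<in> \<int>" if "n \<ge> nat q" for n
    proof -
      have "nat q dvd fact n" using that q by (intro dvd_fact) auto
      then obtain c where "fact n = nat q * c" by auto
      then have "(fact n :: real) = of_int q * of_nat c"
        by (metis (mono_tags) of_nat_fact of_nat_mult of_nat_nat q(1) less_imp_le)
      then have "a * fact n = of_int p * of_nat c" using q by simp
      then show ?thesis by simp
    qed
    then show ?thesis using q by (intro exI[of _ "nat q"]) auto
  qed
  obtain n1 n2 where "\<forall>n\<ge>n1. a * fact n \<in> (\<int>::real set)" "\<forall>n\<ge>n2. b * fact n \<in> (\<int>::real set)"
    using *[OF assms(1)] *[OF assms(2)] by blast
  then show ?thesis by (intro exI[of _ "max n1 n2"]) auto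
qed

text \<open>The endpoint \<open>a\<close> may lie anywhere on the grid, also below 0 or above 1: the
  condition \<open>real v < a * real k\<close> then selects no cell or all of them.\<close>

lemma lessThan_eq_Union_Ik:
  assumes "a * real k \<in> \<int>" "0 < k"
  shows "{0..<1} \<inter> {..<a} = (\<Union>v\<in>{v\<in>{..<k}. real v < a * real k}. Ik k v)"
proof -
  obtain z where z: "a * real k = of_int z" using assms(1) by (auto elim: Ints_cases)
  have "x < a \<longleftrightarrow> \<lfloor>x * real k\<rfloor> < z" for x
    using assms(2) z by (subst floor_less_iff) (simp flip: z)
  moreover have "0 \<le> x \<and> x < 1 \<longleftrightarrow> (\<exists>v<k. \<lfloor>x * real k\<rfloor> = int v)" for x
  proof
    assume x: "0 \<le> x \<and> x < 1"
    then have *: "0 \<le> \<lfloor>x * real k\<rfloor>" "\<lfloor>x * real k\<rfloor> < int k"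
      using assms(2) by (auto simp: floor_less_iff)
    show "\<exists>v<k. \<lfloor>x * real k\<rfloor> = int v"
      by (rule exI[of _ "nat \<lfloor>x * real k\<rfloor>"]) (use * in linarith)
  next
    assume "\<exists>v<k. \<lfloor>x * real k\<rfloor> = int v"
    then obtain v where "v < k" "x \<in> Ik k v" using Ik_iff_floor[OF assms(2)] by auto
    then show "0 \<le> x \<and> x < 1"
      using Ik_subset_unit[of v k] by auto
  qed
  moreover have "real v < a * real k \<longleftrightarrow> int v < z" for v unfolding z by linarith
  ultimately show ?thesis
    using assms(2) by (auto simp: Ik_iff_floor)
qed

text \<open>A rectangle with rational corners, cut down to \<open>[0,1)^2\<close>, is a finite union
  of cells of one factorial level, so its mass is a finite sum of measurable functions. The cells do
  not see the edges where a coordinate equals 1; the concentration hypothesis makes the cut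
  harmless.\<close>

lemma measurable_prob_algebra_cells:
  assumes F: "\<And>w. w \<in> space \<Omega> \<Longrightarrow> F w \<in> space (prob_algebra Sq)"
    and conc: "\<And>w. w \<in> space \<Omega> \<Longrightarrow> measure (F w) ({0..<1} \<times> {0..<1}) = 1"
    and cells: "\<And>n v u. v < fact n \<Longrightarrow> u < fact n \<Longrightarrow>
      (\<lambda>w. measure (F w) (Ik (fact n) v \<times> Ik (fact n) u)) \<in> borel_measurable \<Omega>"
  shows "F \<in> measurable \<Omega> (prob_algebra Sq)"
proof (rule measurable_prob_algebra_generated[OF sets_Sq_eq])
  let ?G = "{({0..1}\<inter>{..<a}) \<times> ({0..1}\<inter>{..<b}) | a b. a \<in> (\<rat>::real set) \<and> b \<in> (\<rat>::real set)}"
  show "Int_stable ?G"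
  proof (rule Int_stableI)
    fix X Y assume "X \<in> ?G" "Y \<in> ?G"
    then obtain a b c d where r: "a \<in> \<rat>" "b \<in> \<rat>" "c \<in> \<rat>" "d \<in> \<rat>"
      and X: "X = ({0..1} \<inter> {..<a}) \<times> ({0..1} \<inter> {..<b})"
      and Y: "Y = ({0..1} \<inter> {..<c}) \<times> ({0..1} \<inter> {..<d})" by blast
    have "X \<inter> Y = ({0..1} \<inter> {..<min a c}) \<times> ({0..1} \<inter> {..<min b d})"
      by (auto simp: X Y)
    moreover have "min a c \<in> \<rat>" "min b d \<in> \<rat>" using r by (auto simp: min_def)
    ultimately show "X \<inter> Y \<in> ?G" by blast
  qed
  fix A assume "A \<in> ?G"
  then obtain a b :: real where ab: "a \<in> \<rat>" "b \<in> \<rat>" and A: "A = ({0..1}\<inter>{..<a}) \<times> ({0..1}\<inter>{..<b})"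
    by auto
  obtain n where n: "a * real (fact n) \<in> \<int>" "b * real (fact n) \<in> \<int>"
    using Rats_common_fact_denominator[OF ab] by auto
  let ?k = "fact n :: nat"
  let ?S = "\<lambda>a. {v\<in>{..<?k}. real v < a * real ?k}"
  have eq: "emeasure (F w) A = (\<Sum>v\<in>?S a. \<Sum>u\<in>?S b. ennreal (measure (F w) (Ik ?k v \<times> Ik ?k u)))"
    if w: "w \<in> space \<Omega>" for w
  proof -
    have M: "prob_space (F w)" "sets (F w) = sets Sq" using F[OF w] by (auto simp: space_prob_algebra)
    interpret prob_space "F w" by fact
    have ev[measurable]: "{0..<1}\<times>{0..<1} \<in> events" "A \<in> events"
      unfolding M A by (auto intro!: Times_in_sets_Sq)
    have "AE x in F w. x \<in> {0..<1}\<times>{0..<1}"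
      using conc[OF w] ev by (subst prob_eq_1[symmetric]) auto
    then have "prob A = prob (A \<inter> {0..<1}\<times>{0..<1})"
      by (intro finite_measure_eq_AE) auto
    also have "A \<inter> {0..<1}\<times>{0..<1} = ({0..<1} \<inter> {..<a}) \<times> ({0..<1} \<inter> {..<b})"
      by (auto simp: A)
    also have "\<dots> = (\<Union>v\<in>?S a. Ik ?k v) \<times> (\<Union>v\<in>?S b. Ik ?k v)"
      using n by (simp only: lessThan_eq_Union_Ik fact_gt_zero)
    also have "prob \<dots> = (\<Sum>v\<in>?S a. \<Sum>u\<in>?S b. prob (Ik ?k v \<times> Ik ?k u))"
      by (rule measure_Union_cells[OF M]) auto
    finally show ?thesis by (simp add: emeasure_eq_measure sum_nonneg)
  qed
  have "(\<lambda>w. \<Sum>v\<in>?S a. \<Sum>u\<in>?S b. ennreal (measure (F w) (Ik ?k v \<times> Ik ?k u))) \<in> borel_measurable \<Omega>"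
    by (intro borel_measurable_sum measurable_compose[OF cells measurable_ennreal]) auto
  then show "(\<lambda>w. emeasure (F w) A) \<in> borel_measurable \<Omega>"
    by (subst measurable_cong[OF eq]) auto
qed (use F in \<open>auto simp: space_prob_algebra\<close>)

subsection \<open>Equipartitions and convergence in probability\<close>

text \<open>The last class receives its prescribed points and is filled up to size \<open>n\<close>
  with points that no other class has reserved. The other \<open>k\<close> classes reserve at most
  \<open>n * k\<close> of the \<open>n * (k + 1)\<close> points, so enough are left. The ground set
  is an arbitrary finite \<open>S\<close> because the induction removes a class from it.\<close>

lemma extend_to_equipartition:
  assumes "finite S" "card S = n * k" "\<And>i. i < k \<Longrightarrow> E i \<subseteq> S" "\<And>i. i < k \<Longrightarrow> card (E i) \<le> n"
    "disjoint_family_on E {..<k}"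
  shows "\<exists>d. d \<in> S \<rightarrow> {..<k} \<and> (\<forall>i<k. card {v\<in>S. d v = i} = n) \<and> (\<forall>i<k. \<forall>v\<in>E i. d v = i)"
  using assms
proof (induction k arbitrary: S)
  case 0
  then show ?case by auto
next
  case (Suc k)
  have ES: "(\<Union>i<k. E i) \<subseteq> S" by (intro UN_least Suc.prems(3)) simp
  \<comment> \<open>The points available to class \<open>k\<close>; \<open>D\<close> below is chosen
    between \<open>E k\<close> and this set.\<close>
  define T where "T = S - (\<Union>i<k. E i)"
  have "card (\<Union>i<k. E i) \<le> (\<Sum>i<k. card (E i))" by (rule card_UN_le) simp
  also have "\<dots> \<le> (\<Sum>i<k. n)" using Suc.prems by (intro sum_mono) auto
  finally have "card (\<Union>i<k. E i) \<le> n * k" by (simp add: mult.commute)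
  moreover have "card T = card S - card (\<Union>i<k. E i)"
    unfolding T_def using ES finite_subset[OF _ Suc.prems(1)] by (intro card_Diff_subset) auto
  ultimately have "n \<le> card T" using Suc.prems by simp
  moreover have "E k \<subseteq> T"
  proof -
    have "E k \<inter> E i = {}" if "i < k" for i
      using that by (intro disjoint_family_onD[OF Suc.prems(5)]) auto
    then show ?thesis using Suc.prems(3)[of k] by (auto simp: T_def)
  qed
  moreover have "finite T" using Suc.prems by (simp add: T_def)
  ultimately obtain D where D: "E k \<subseteq> D" "D \<subseteq> T" "card D = n"
    using exists_subset_between[of "E k" n T] Suc.prems by auto
  have DS: "D \<subseteq> S" "finite D" using D Suc.prems by (auto simp: T_def intro: finite_subset)
  have "\<exists>d. d \<in> (S - D) \<rightarrow> {..<k} \<and> (\<forall>i<k. card {v\<in>S - D. d v = i} = n) \<and> (\<forall>i<k. \<forall>v\<in>E i. d v = i)"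
  proof (rule Suc.IH)
    show "card (S - D) = n * k" using Suc.prems D DS by (subst card_Diff_subset) auto
    show "E i \<subseteq> S - D" if "i < k" for i using D that Suc.prems(3)[of i] by (auto simp: T_def)
    show "disjoint_family_on E {..<k}"
      by (rule disjoint_family_on_mono[OF _ Suc.prems(5)]) auto
  qed (use Suc.prems in auto)
  then obtain d where d: "d \<in> (S - D) \<rightarrow> {..<k}" "\<And>i. i < k \<Longrightarrow> card {v\<in>S - D. d v = i} = n"
    "\<And>i v. i < k \<Longrightarrow> v \<in> E i \<Longrightarrow> d v = i" by blast
  define d' where "d' v = (if v \<in> D then k else d v)" for v
  have "card {v\<in>S. d' v = i} = n" if "i < Suc k" for i
  proof (cases "i = k")
    case True
    then have "{v\<in>S. d' v = i} = D" using DS d(1) by (auto simp: d'_def split: if_splits)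
    then show ?thesis using D by simp
  next
    case False
    then have "{v\<in>S. d' v = i} = {v\<in>S - D. d v = i}" by (auto simp: d'_def)
    then show ?thesis using d(2) that False by simp
  qed
  moreover have "d' v = i" if "i < Suc k" "v \<in> E i" for i v
    using that d(3) D by (cases "i = k") (auto simp: d'_def T_def)
  moreover have "d' \<in> S \<rightarrow> {..<Suc k}" using d(1) by (auto simp: d'_def Pi_iff less_Suc_eq)
  ultimately show ?case by blast
qed

section \<open>Equality of laws from closeness in probability\<close>

text \<open>A comparison of distribution functions in finite dimension, in the manner of the Levy
  metric. Orthants with strict inequalities are increasing unions of their shifts by
  \<open>\<eta>\<close>, so continuity from below removes first \<open>\<epsilon>\<close> and then
  \<open>\<eta>\<close>. Such orthants form an intersection-stable generator.\<close>

lemma PiM_eq_if_orthants_close: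
  fixes M N :: "('i \<Rightarrow> real) measure"
  assumes I: "finite I" and M: "prob_space M" "sets M = sets (PiM I (\<lambda>_. borel))"
    and N: "prob_space N" "sets N = sets (PiM I (\<lambda>_. borel))"
    and MN: "\<And>a \<eta> \<epsilon>. 0 < \<eta> \<Longrightarrow> 0 < \<epsilon> \<Longrightarrow> measure M {x\<in>space M. \<forall>i\<in>I. x i < a i - \<eta>} \<le> measure N {x\<in>space N. \<forall>i\<in>I. x i < a i} + \<epsilon>"
    and NM: "\<And>a \<eta> \<epsilon>. 0 < \<eta> \<Longrightarrow> 0 < \<epsilon> \<Longrightarrow> measure N {x\<in>space N. \<forall>i\<in>I. x i < a i - \<eta>} \<le> measure M {x\<in>space M. \<forall>i\<in>I. x i < a i} + \<epsilon>"
  shows "M = N"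
proof -
  let ?\<Omega> = "I \<rightarrow>\<^sub>E (UNIV :: real set)"
  define U where "U a = {x\<in>?\<Omega>. \<forall>i\<in>I. x i < a i}" for a :: "'i \<Rightarrow> real"
  have sp: "space M = ?\<Omega>" "space N = ?\<Omega>"
    using M(2) N(2) by (auto dest!: sets_eq_imp_space_eq simp: space_PiM)
  have U_sets: "U a \<in> sets (PiM I (\<lambda>_. borel))" for a
  proof -
    have "U a = PiE I (\<lambda>i. {..<a i})" by (auto simp: U_def)
    then show ?thesis using I by (auto intro!: sets_PiM_I_finite)
  qed
  have U_mono: "U a \<subseteq> U b" if "\<And>i. a i \<le> b i" for a b
    using that by (auto simp: U_def intro: less_le_trans)
  have le: "measure M (U a) \<le> measure N (U a)" if M: "prob_space M" "sets M = sets (PiM I (\<lambda>_. borel))"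
    and MN: "\<And>\<eta> \<epsilon>. 0 < \<eta> \<Longrightarrow> 0 < \<epsilon> \<Longrightarrow> measure M (U (\<lambda>i. a i - \<eta>)) \<le> measure N (U a) + \<epsilon>"
    for M N :: "('i \<Rightarrow> real) measure" and a
  proof -
    interpret prob_space M by fact
    let ?e = "\<lambda>s. 1 / real (Suc s)"
    have "(\<lambda>s. measure M (U (\<lambda>i. a i - ?e s))) \<longlonglongrightarrow> measure M (\<Union>s. U (\<lambda>i. a i - ?e s))"
    proof (rule finite_Lim_measure_incseq)
      show "range (\<lambda>s. U (\<lambda>i. a i - ?e s)) \<subseteq> sets M" using U_sets M by auto
      show "incseq (\<lambda>s. U (\<lambda>i. a i - ?e s))"
        by (intro incseq_SucI U_mono) (simp add: field_simps)
    qed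
    moreover have "(\<Union>s. U (\<lambda>i. a i - ?e s)) = U a"
    proof (intro equalityI subsetI)
      fix x assume "x \<in> (\<Union>s. U (\<lambda>i. a i - ?e s))"
      then show "x \<in> U a" using U_mono[of "\<lambda>i. a i - ?e _" a] by fastforce
    next
      fix x assume x: "x \<in> U a"
      show "x \<in> (\<Union>s. U (\<lambda>i. a i - ?e s))"
      proof (cases "I = {}")
        case False
        \<comment> \<open>The smallest slack of \<open>x\<close> in its finitely many strict
          inequalities; any shift below it keeps \<open>x\<close> inside.\<close>
        define r where "r = Min ((\<lambda>i. a i - x i) ` I)"
        have "r > 0" using x I False by (auto simp: r_def U_def)
        then obtain s where s: "?e s < r" using nat_approx_posE by blast
        have "r \<le> a i - x i" if "i \<in> I" for i using I that by (auto simp: r_def)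
        then have "x \<in> U (\<lambda>i. a i - ?e s)" using x s by (force simp: U_def)
        then show ?thesis by blast
      qed (use x in \<open>auto simp: U_def\<close>)
    qed
    moreover have "measure M (U (\<lambda>i. a i - ?e s)) \<le> measure N (U a)" for s
      by (rule field_le_epsilon) (use MN in auto)
    ultimately show ?thesis by (auto intro: LIMSEQ_le_const2)
  qed
  have eqU: "measure M (U a) = measure N (U a)" for a
    using le[OF M, of a N] le[OF N, of a M] MN[of _ _ a] NM[of _ _ a] unfolding sp U_def
    by (intro antisym) auto
  interpret M: prob_space M by fact
  interpret N: prob_space N by fact
  have RU: "range U \<subseteq> Pow ?\<Omega>" by (auto simp: U_def)
  have gen: "sets (PiM I (\<lambda>_. borel :: real measure)) = sigma_sets ?\<Omega> (range U)"
  proof (rule antisym)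
    have "(\<lambda>x. x) \<in> measurable (sigma ?\<Omega> (range U)) (PiM I (\<lambda>_. borel))"
    proof (rule measurable_PiM_single')
      fix i assume i: "i \<in> I"
      show "(\<lambda>x. x i) \<in> borel_measurable (sigma ?\<Omega> (range U))"
        unfolding borel_measurable_iff_less
      proof
        fix c :: real
        \<comment> \<open>A half-space is exhausted by orthants whose bounds in the other directions
          tend to infinity.\<close>
        have "{x\<in>?\<Omega>. x i < c} = (\<Union>s::nat. U (\<lambda>j. if j = i then c else real s))"
        proof (intro equalityI subsetI)
          fix x assume x: "x \<in> {x\<in>?\<Omega>. x i < c}"
          obtain s :: nat where "Max (x ` I) < real s" using reals_Archimedean2 by blast
          then have "\<forall>j\<in>I. x j < real s" using I by (subst (asm) Max_less_iff) (use i in auto)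
          then show "x \<in> (\<Union>s::nat. U (\<lambda>j. if j = i then c else real s))" using x by (auto simp: U_def)
        qed (use i in \<open>auto simp: U_def split: if_splits\<close>)
        also have "\<dots> \<in> sigma_sets ?\<Omega> (range U)" by (intro sigma_sets_UNION) auto
        finally show "{x\<in>space (sigma ?\<Omega> (range U)). x i < c} \<in> sets (sigma ?\<Omega> (range U))"
          using RU by simp
      qed
    qed (auto simp: space_measure_of_conv)
    then have "(\<lambda>x. x) -` A \<inter> space (sigma ?\<Omega> (range U)) \<in> sets (sigma ?\<Omega> (range U))"
      if "A \<in> sets (PiM I (\<lambda>_. borel))" for A
      using that by (rule measurable_sets)
    then show "sets (PiM I (\<lambda>_. borel :: real measure)) \<subseteq> sigma_sets ?\<Omega> (range U)"
      using RU sets.sets_into_space[of _ "PiM I (\<lambda>_. borel :: real measure)"]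
      by (auto simp: space_PiM Int_absorb2)
    show "sigma_sets ?\<Omega> (range U) \<subseteq> sets (PiM I (\<lambda>_. borel :: real measure))"
      using sets.sigma_sets_subset[of "range U" "PiM I (\<lambda>_. borel)"] U_sets by (auto simp: space_PiM)
  qed
  show ?thesis
  proof (rule measure_eqI_generator_eq[where E = "range U" and \<Omega> = ?\<Omega> and A = "\<lambda>s. U (\<lambda>_. real s)"])
    show "Int_stable (range U)"
    proof (rule Int_stableI, safe)
      fix a b
      have "U a \<inter> U b = U (\<lambda>i. min (a i) (b i))" by (auto simp: U_def)
      then show "U a \<inter> U b \<in> range U" by simp
    qed
    show "(\<Union>s. U (\<lambda>_. real s)) = ?\<Omega>"
    proof (intro equalityI subsetI)
      fix x :: "'i \<Rightarrow> real" assume x: "x \<in> ?\<Omega>"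
      obtain s :: nat where "Max (insert 0 (x ` I)) < real s" using reals_Archimedean2 by blast
      then have "\<forall>j\<in>I. x j < real s" using I by (subst (asm) Max_less_iff) auto
      then show "x \<in> (\<Union>s. U (\<lambda>_. real s))" using x by (auto simp: U_def)
    qed (auto simp: U_def)
  qed (use RU M N gen eqU in \<open>auto simp: M.emeasure_eq_measure N.emeasure_eq_measure\<close>)
qed

text \<open>If \<open>Y\<close> lies below \<open>a - \<eta>\<close> in every coordinate, then
  either \<open>Z\<close> lies below \<open>a\<close> or some coordinate of \<open>Y\<close> and
  \<open>Z\<close> differs by at least \<open>\<eta>\<close>, and the roles can be exchanged. The
  approximations all have the same law \<open>N\<close>, so no passage to a limit of laws
  occurs.\<close>

lemma distr_eq_of_approx_in_prob:
  fixes Y :: "'a \<Rightarrow> 'i \<Rightarrow> real"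
  assumes I: "finite I" and \<Omega>: "prob_space \<Omega>" and Y: "Y \<in> measurable \<Omega> (PiM I (\<lambda>_. borel))"
    and approx: "\<And>\<eta> \<epsilon>. 0 < \<eta> \<Longrightarrow> 0 < \<epsilon> \<Longrightarrow> \<exists>Z\<in>measurable \<Omega> (PiM I (\<lambda>_. borel)).
      distr \<Omega> (PiM I (\<lambda>_. borel)) Z = N \<and> measure \<Omega> {w\<in>space \<Omega>. \<exists>i\<in>I. \<eta> \<le> \<bar>Y w i - Z w i\<bar>} \<le> \<epsilon>"
  shows "distr \<Omega> (PiM I (\<lambda>_. borel)) Y = N"
proof -
  interpret prob_space \<Omega> by fact
  have close: "prob {w\<in>space \<Omega>. \<forall>i\<in>I. Y w i < a i - \<eta>} \<le> prob {w\<in>space \<Omega>. \<forall>i\<in>I. Z w i < a i} + \<epsilon>"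
    if [measurable]: "Y \<in> measurable \<Omega> (PiM I (\<lambda>_. borel))" "Z \<in> measurable \<Omega> (PiM I (\<lambda>_. borel))"
      and bad: "prob {w\<in>space \<Omega>. \<exists>i\<in>I. \<eta> \<le> \<bar>Y w i - Z w i\<bar>} \<le> \<epsilon>"
    for Y Z :: "'a \<Rightarrow> 'i \<Rightarrow> real" and a \<eta> \<epsilon>
  proof -
    have comp: "(\<lambda>w. V w i) \<in> borel_measurable \<Omega>"
      if "V \<in> measurable \<Omega> (PiM I (\<lambda>_. borel))" "i \<in> I" for V :: "'a \<Rightarrow> 'i \<Rightarrow> real" and i
      using that(2) measurable_compose[OF that(1) measurable_component_singleton[OF that(2)]] by simp
    have [measurable]: "{w\<in>space \<Omega>. \<forall>i\<in>I. V w i < a i} \<in> events"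
      if "V \<in> measurable \<Omega> (PiM I (\<lambda>_. borel))" for V and a :: "'i \<Rightarrow> real"
      using comp[OF that] I by (intro sets.sets_Collect_finite_All) (auto intro: borel_measurable_less)
    have [measurable]: "{w\<in>space \<Omega>. \<exists>i\<in>I. \<eta> \<le> \<bar>Y w i - Z w i\<bar>} \<in> events"
      using comp[OF that(1)] comp[OF that(2)] I
      by (intro sets.sets_Collect_finite_Ex) (auto intro!: borel_measurable_le)
    have "{w\<in>space \<Omega>. \<forall>i\<in>I. Y w i < a i - \<eta>}
        \<subseteq> {w\<in>space \<Omega>. \<forall>i\<in>I. Z w i < a i} \<union> {w\<in>space \<Omega>. \<exists>i\<in>I. \<eta> \<le> \<bar>Y w i - Z w i\<bar>}"
      by (auto simp: not_le) (smt (verit))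
    then have "prob {w\<in>space \<Omega>. \<forall>i\<in>I. Y w i < a i - \<eta>}
        \<le> prob ({w\<in>space \<Omega>. \<forall>i\<in>I. Z w i < a i} \<union> {w\<in>space \<Omega>. \<exists>i\<in>I. \<eta> \<le> \<bar>Y w i - Z w i\<bar>})"
      using that by (intro finite_measure_mono) auto
    also have "\<dots> \<le> prob {w\<in>space \<Omega>. \<forall>i\<in>I. Z w i < a i} + prob {w\<in>space \<Omega>. \<exists>i\<in>I. \<eta> \<le> \<bar>Y w i - Z w i\<bar>}"
      using that by (intro measure_Un_le) auto
    finally show ?thesis using bad by simp
  qed
  have dist: "measure (distr \<Omega> (PiM I (\<lambda>_. borel)) V) {x\<in>space (PiM I (\<lambda>_. borel)). \<forall>i\<in>I. x i < a i}
      = prob {w\<in>space \<Omega>. \<forall>i\<in>I. V w i < a i}"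
    if V: "V \<in> measurable \<Omega> (PiM I (\<lambda>_. borel))" for V and a :: "'i \<Rightarrow> real"
  proof -
    have "{x\<in>space (PiM I (\<lambda>_. borel)). \<forall>i\<in>I. x i < a i} \<in> sets (PiM I (\<lambda>_. borel :: real measure))"
      using I by (intro sets.sets_Collect_finite_All) (auto intro!: borel_measurable_less)
    then show ?thesis
      using measurable_space[OF V] by (subst measure_distr[OF V]) (auto intro!: arg_cong[where f=prob])
  qed
  obtain Z0 where Z0: "Z0 \<in> measurable \<Omega> (PiM I (\<lambda>_. borel))" "distr \<Omega> (PiM I (\<lambda>_. borel)) Z0 = N"
    using approx[OF zero_less_one zero_less_one] by blast
  have N: "prob_space N" "sets N = sets (PiM I (\<lambda>_. borel))"
    using prob_space_distr[OF Z0(1)] by (auto simp flip: Z0(2))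
  show ?thesis
  proof (rule PiM_eq_if_orthants_close[OF I _ _ N])
    fix a and \<eta> \<epsilon> :: real assume "0 < \<eta>" "0 < \<epsilon>"
    from approx[OF this] obtain Z where Z: "Z \<in> measurable \<Omega> (PiM I (\<lambda>_. borel))"
      "distr \<Omega> (PiM I (\<lambda>_. borel)) Z = N" "prob {w\<in>space \<Omega>. \<exists>i\<in>I. \<eta> \<le> \<bar>Y w i - Z w i\<bar>} \<le> \<epsilon>" by blast
    have spN: "space N = space (PiM I (\<lambda>_. borel :: real measure))" using N(2) by (rule sets_eq_imp_space_eq)
    show "measure (distr \<Omega> (PiM I (\<lambda>_. borel)) Y)
        {x\<in>space (distr \<Omega> (PiM I (\<lambda>_. borel)) Y). \<forall>i\<in>I. x i < a i - \<eta>}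
      \<le> measure N {x\<in>space N. \<forall>i\<in>I. x i < a i} + \<epsilon>"
      unfolding space_distr dist[OF Y] spN Z(2)[symmetric] dist[OF Z(1)] by (rule close[OF Y Z(1,3)])
    show "measure N {x\<in>space N. \<forall>i\<in>I. x i < a i - \<eta>}
      \<le> measure (distr \<Omega> (PiM I (\<lambda>_. borel)) Y) {x\<in>space (distr \<Omega> (PiM I (\<lambda>_. borel)) Y). \<forall>i\<in>I. x i < a i} + \<epsilon>"
      unfolding space_distr dist[OF Y] spN Z(2)[symmetric] dist[OF Z(1)]
      by (rule close[OF Z(1) Y]) (use Z(3) in \<open>simp add: abs_minus_commute\<close>)
  qed (use prob_space_distr[OF Y] in auto)
qed

subsection \<open>Laws of random measures are determined by cell masses\<close>

lemma fact_quotientE: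
  assumes "n \<le> m" obtains q where "0 < q" "(fact m :: nat) = q * fact n"
  using fact_dvd[OF assms, where 'a=nat] by (metis dvd_def fact_gt_zero mult.commute mult_eq_0_iff neq0_conv)

lemma unit_square_sets: "{0..<1} \<times> {0..<1} \<in> sets Sq"
  by (intro Times_in_sets_Sq) auto

text \<open>On the set \<open>H\<close> of measures carried by \<open>[0,1)^2\<close>, the events
  described by one matrix \<open>Gk (fact n)\<close> form a generator of the trace \<sigma>-algebra.
  It is intersection-stable because two levels can be read off from the larger one. Both laws give
  \<open>H\<close> full mass, so agreement there is agreement everywhere.\<close>

lemma law_determined_by_Gk:
  assumes P: "prob_space P" "sets P = sets (prob_algebra Sq)"
    and Q: "prob_space Q" "sets Q = sets (prob_algebra Sq)"
    and eq: "\<And>n. distr P (MatSpace (fact n)) (Gk (fact n)) = distr Q (MatSpace (fact n)) (Gk (fact n))"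
    and concP: "AE m in P. measure m ({0..<1} \<times> {0..<1}) = 1"
    and concQ: "AE m in Q. measure m ({0..<1} \<times> {0..<1}) = 1"
  shows "P = Q"
proof -
  let ?A = "prob_algebra Sq"
  define H where "H = {m \<in> space ?A. measure m ({0..<1} \<times> {0..<1}) = 1}"
  have H_sets: "H \<in> sets ?A" unfolding H_def
    using measurable_measure_prob_algebra[OF unit_square_sets] by measurable
  define G where "G = {Gk (fact n) -` X \<inter> H | n X. X \<in> sets (MatSpace (fact n))}"
  have G_sub: "G \<subseteq> Pow H" by (auto simp: G_def)
  have G_sets: "A \<in> sets ?A" if AG: "A \<in> G" for A
  proof -
    obtain n X where A: "A = Gk (fact n) -` X \<inter> H" "X \<in> sets (MatSpace (fact n))"
      using AG unfolding G_def by blast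
    then have "A = (Gk (fact n) -` X \<inter> space ?A) \<inter> H" by (auto simp: H_def)
    then show ?thesis using measurable_sets[OF measurable_Gk A(2)] H_sets by simp
  qed
  have Gk_meas: "Gk (fact n) \<in> measurable (sigma H G) (MatSpace (fact n))" for n
  proof (rule measurableI)
    fix m assume "m \<in> space (sigma H G)"
    then show "Gk (fact n) m \<in> space (MatSpace (fact n))"
      by (auto simp: Gk_def MatSpace_def space_PiM)
  next
    fix X assume "X \<in> sets (MatSpace (fact n))"
    then have "Gk (fact n) -` X \<inter> H \<in> G" unfolding G_def by blast
    then show "Gk (fact n) -` X \<inter> space (sigma H G) \<in> sets (sigma H G)"
      using G_sub by (simp add: space_measure_of_conv sigma_sets.Basic)
  qed
  \<comment> \<open>This is the generation claim: cell masses suffice for measurability on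
    \<open>H\<close>, so every measurable set of measures has its trace on \<open>H\<close> in
    \<open>sigma_sets H G\<close>.\<close>
  have id: "(\<lambda>m. m) \<in> measurable (sigma H G) ?A"
  proof (rule measurable_prob_algebra_cells)
    fix n v u :: nat assume vu: "v < fact n" "u < fact n"
    then have "(\<lambda>m. Gk (fact n) m (v, u)) \<in> borel_measurable (sigma H G)"
      using measurable_compose[OF Gk_meas[of n, unfolded MatSpace_def]
          measurable_component_singleton[of "(v, u)" "grid (fact n)"]]
      by (simp add: grid_def)
    then show "(\<lambda>m. measure m (Ik (fact n) v \<times> Ik (fact n) u)) \<in> borel_measurable (sigma H G)"
      using vu by (simp add: Gk_def grid_def)
  qed (auto simp: space_measure_of_conv H_def)
  have Int_G: "Int_stable G"
  proof (rule Int_stableI)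
    fix A B assume "A \<in> G" "B \<in> G"
    then obtain n X n' X' where
      A: "A = Gk (fact n) -` X \<inter> H" "X \<in> sets (MatSpace (fact n))" and
      B: "B = Gk (fact n') -` X' \<inter> H" "X' \<in> sets (MatSpace (fact n'))"
      unfolding G_def by blast
    define m where "m = max n n'"
    have lift: "\<exists>Y\<in>sets (MatSpace (fact m)). Gk (fact n) -` X \<inter> H = Gk (fact m) -` Y \<inter> H"
      if "n \<le> m" "X \<in> sets (MatSpace (fact n))" for n X
    proof -
      obtain q where q: "0 < q" "(fact m :: nat) = q * fact n" using fact_quotientE[OF \<open>n \<le> m\<close>] .
      let ?r = "rho (fact m) (fact n) (\<lambda>v. v div q)"
      have "?r -` X \<inter> space (MatSpace (fact m)) \<in> sets (MatSpace (fact m))"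
        by (rule measurable_sets[OF measurable_rho that(2)])
      moreover have "?r (Gk (fact m) M) = Gk (fact n) M" if "M \<in> H" for M
        unfolding q(2) using that q(1) by (intro rho_Gk_coarsen) (auto simp: H_def space_prob_algebra)
      then have "Gk (fact n) -` X \<inter> H = Gk (fact m) -` (?r -` X \<inter> space (MatSpace (fact m))) \<inter> H"
        by (auto simp: MatSpace_def space_PiM Gk_def)
      ultimately show ?thesis by blast
    qed
    obtain Y Y' where Y: "Y \<in> sets (MatSpace (fact m))" "A = Gk (fact m) -` Y \<inter> H"
      "Y' \<in> sets (MatSpace (fact m))" "B = Gk (fact m) -` Y' \<inter> H"
      using lift[OF _ A(2)] lift[OF _ B(2)] A B by (auto simp: m_def)
    then have "A \<inter> B = Gk (fact m) -` (Y \<inter> Y') \<inter> H" "Y \<inter> Y' \<in> sets (MatSpace (fact m))" by auto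
    then show "A \<inter> B \<in> G" unfolding G_def by blast
  qed
  have sets_R: "sets (restrict_space R H) = sigma_sets H G" if R: "sets R = sets ?A" for R
  proof (rule antisym)
    have "H \<inter> A \<in> sigma_sets H G" if "A \<in> sets ?A" for A
      using measurable_sets[OF id that] G_sub by (simp add: Int_commute space_measure_of_conv)
    then show "sets (restrict_space R H) \<subseteq> sigma_sets H G"
      using R by (auto simp: sets_restrict_space)
    have "G \<subseteq> sets (restrict_space R H)"
      using G_sets G_sub R H_sets by (auto simp: sets_restrict_space_iff)
    moreover have "space (restrict_space R H) = H"
      using H_sets R sets.sets_into_space[of H R] by (auto simp: space_restrict_space)
    ultimately show "sigma_sets H G \<subseteq> sets (restrict_space R H)"
      using sets.sigma_sets_subset[of G "restrict_space R H"] by simp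
  qed
  have em: "emeasure R (B \<inter> H) = emeasure R B"
    if "sets R = sets ?A" "AE m in R. measure m ({0..<1} \<times> {0..<1}) = 1" "B \<in> sets ?A" for R B
  proof (rule emeasure_eq_AE)
    show "AE m in R. (m \<in> B \<inter> H) = (m \<in> B)"
      using that(2) AE_space by eventually_elim (use sets_eq_imp_space_eq[OF that(1)] in \<open>auto simp: H_def\<close>)
  qed (use that H_sets in auto)
  have emG: "emeasure R (Gk (fact n) -` X \<inter> H) = emeasure (distr R (MatSpace (fact n)) (Gk (fact n))) X"
    if R: "sets R = sets ?A" "AE m in R. measure m ({0..<1} \<times> {0..<1}) = 1" and X: "X \<in> sets (MatSpace (fact n))" for R n X
  proof -
    have "Gk (fact n) -` X \<inter> H = (Gk (fact n) -` X \<inter> space R) \<inter> H"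
      using sets_eq_imp_space_eq[OF R(1)] by (auto simp: H_def)
    moreover have "Gk (fact n) \<in> measurable R (MatSpace (fact n))"
      using measurable_Gk by (simp cong: measurable_cong_sets add: R)
    moreover have "Gk (fact n) -` X \<inter> space R \<in> sets ?A"
      using measurable_sets[OF measurable_Gk X] sets_eq_imp_space_eq[OF R(1)] by simp
    ultimately show ?thesis using em[OF R] X by (simp add: emeasure_distr)
  qed
  have "restrict_space P H = restrict_space Q H"
  proof (rule measure_eqI_generator_eq[OF Int_G G_sub _ sets_R sets_R])
    fix A assume "A \<in> G"
    then show "emeasure (restrict_space P H) A = emeasure (restrict_space Q H) A"
      using G_sub H_sets P Q by (auto simp: emeasure_restrict_space G_def emG concP concQ eq)
  next
    \<comment> \<open>\<open>H\<close> itself is in the generator, as the preimage of the whole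
      space; it serves as the constant exhausting sequence.\<close>
    have "Gk (fact 0) -` space (MatSpace (fact 0)) \<inter> H = H"
      by (auto simp: MatSpace_def space_PiM Gk_def)
    then have "H \<in> G" unfolding G_def by blast
    then show "range (\<lambda>_::nat. H) \<subseteq> G" by auto
    show "emeasure (restrict_space P H) H \<noteq> \<infinity>"
      using prob_space.emeasure_le_1[OF P(1)] H_sets P by (simp add: emeasure_restrict_space)
        (metis ennreal_one_less_top leD)
  qed (use P Q in auto)
  then have RH: "emeasure (restrict_space P H) A = emeasure (restrict_space Q H) A" for A by simp
  show ?thesis
  proof (rule measure_eqI)
    fix A assume "A \<in> sets P"
    then have A: "A \<in> sets ?A" using P by simp
    have "emeasure P A = emeasure P (A \<inter> H)" using em[OF P(2) concP A] by simp
    also have "\<dots> = emeasure Q (A \<inter> H)"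
      using RH[of "A \<inter> H"] H_sets P Q by (simp add: emeasure_restrict_space)
    finally show "emeasure P A = emeasure Q A" using em[OF Q(2) concQ A] by simp
  qed (use P Q in simp)
qed

lemma Delta_sets: "Delta k \<in> sets (MatSpace k)"
  unfolding Delta_def MatSpace_def grid_def by measurable

lemma AE_Delta: "prob_on_Delta k P \<Longrightarrow> AE X in P. X \<in> Delta k"
  using Delta_sets[of k] prob_space.AE_in_set_eq_1[of P "Delta k"]
  by (auto simp: prob_on_Delta_def measure_def)

text \<open>The only cell of level 1 is \<open>[0,1)^2\<close>, not the closed square. A total mass
  of 1 in the matrix of size one therefore forbids mass on the edges where a coordinate equals
  1.\<close>

lemma AE_concentrated:
  assumes P: "sets P = sets (prob_algebra Sq)"
    and "prob_on_Delta 1 (distr P (MatSpace 1) (Gk 1))"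
  shows "AE m in P. measure m ({0..<1} \<times> {0..<1}) = 1"
proof -
  have [measurable]: "Gk 1 \<in> measurable P (MatSpace 1)"
    using measurable_Gk by (simp cong: measurable_cong_sets add: P)
  have "AE X in distr P (MatSpace 1) (Gk 1). X \<in> Delta 1" using assms AE_Delta by blast
  then have "AE m in P. Gk 1 m \<in> Delta 1"
    using Delta_sets by (subst (asm) AE_distr_iff) (auto simp: sets.sets_into_space simp del: One_nat_def)
  then show ?thesis
  proof eventually_elim
    case (elim m)
    have "grid 1 = {(0, 0)}" "Ik 1 0 = {0..<1}" by (auto simp: grid_def Ik_def)
    with elim show ?case by (simp add: Delta_def Gk_def)
  qed
qed

subsection \<open>Approximating measurable partitions by equipartitions\<close>

text \<open>The uniform law lives on all Borel sets of the line, unlike \<open>Leb01\<close>, so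
  that distribution functions and inner regularity apply to it directly.\<close>

definition unif :: "real measure" where "unif = uniform_measure lborel {0..1}"

lemma prob_space_unif: "prob_space unif"
  unfolding unif_def by (rule prob_space_uniform_measure) auto

lemma sets_unif [simp, measurable_cong]: "sets unif = sets borel"
  by (simp add: unif_def)

lemma space_unif [simp]: "space unif = UNIV"
  by (simp add: unif_def)

lemma emeasure_unif: "A \<in> sets borel \<Longrightarrow> emeasure unif A = emeasure lborel ({0..1} \<inter> A)"
  by (simp add: unif_def divide_ennreal_def)

lemma measure_unif_Ik:
  assumes "v < k" shows "measure unif (Ik k v) = 1 / real k"
proof -
  have "{0..1} \<inter> Ik k v = Ik k v" using Ik_subset_unit[OF assms] by force
  moreover have "real v / real k \<le> (real v + 1) / real k" by (simp add: divide_right_mono)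
  ultimately have "emeasure unif (Ik k v) = ennreal ((real v + 1) / real k - real v / real k)"
    by (simp add: emeasure_unif Ik_def)
  then show ?thesis by (simp add: measure_def flip: diff_divide_distrib)
qed

lemma measure_Union_Ik:
  assumes M: "prob_space M" "sets M = sets borel" and cells: "\<And>v. v < k \<Longrightarrow> measure M (Ik k v) = 1 / real k"
    and S: "S \<subseteq> {..<k}"
  shows "measure M (\<Union>v\<in>S. Ik k v) = real (card S) / real k"
proof (cases "k = 0")
  case False
  interpret prob_space M by fact
  have "measure M (\<Union>v\<in>S. Ik k v) = (\<Sum>v\<in>S. measure M (Ik k v))"
    using S False M disjoint_Ik[of k]
    by (intro finite_measure_finite_Union) (auto intro: finite_subset simp: disjoint_family_on_def)
  also have "\<dots> = (\<Sum>v\<in>S. 1 / real k)" using S by (intro sum.cong cells) auto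
  finally show ?thesis by simp
qed (use S in auto)

lemma unit_interval_eq_Union_Ik:
  assumes "0 < k" shows "{0..<1} = (\<Union>v<k. Ik k v)"
proof -
  have "{v\<in>{..<k}. real v < 1 * real k} = {..<k}" by auto
  with lessThan_eq_Union_Ik[of 1 k] assms show ?thesis by auto
qed

lemma inverse_fact_tendsto_0: "(\<lambda>n. 1 / (fact n :: real)) \<longlonglongrightarrow> 0"
  using summable_LIMSEQ_zero[OF summable_exp[of "1::real"]] by (simp add: inverse_eq_divide)

text \<open>Cells of level \<open>n!\<close> pin the distribution function at every point of
  \<open>[0,1)\<close> up to \<open>1 / n!\<close>. They also exhaust the total mass, which settles
  the values outside that interval.\<close>

lemma eq_unif_if_cells:
  assumes M: "prob_space M" "sets M = sets borel"
    and cells: "\<And>n v. v < fact n \<Longrightarrow> measure M (Ik (fact n) v) = 1 / fact n"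
  shows "M = unif"
proof -
  have cdf: "\<bar>cdf N x - x\<bar> \<le> 1 / fact n" if x: "0 \<le> x" "x < 1"
    and N: "prob_space N" "sets N = sets borel"
    and cells: "\<And>n v. v < fact n \<Longrightarrow> measure N (Ik (fact n) v) = 1 / fact n" for N x n
  proof -
    interpret prob_space N by fact
    let ?k = "fact n :: nat"
    have U: "measure N (\<Union>v\<in>S. Ik ?k v) = real (card S) / real ?k" if "S \<subseteq> {..<?k}" for S
      using cells[of _ n] that by (intro measure_Union_Ik[OF N]) auto
    \<comment> \<open>The index of the cell containing \<open>x\<close>: the cells before it lie
      below \<open>x\<close>, and together with it they cover the nonnegative part of
      \<open>{..x}\<close>.\<close>
    define i where "i = nat \<lfloor>x * real ?k\<rfloor>"
    have i: "real i \<le> x * real ?k" "x * real ?k < real i + 1" using x by (auto simp: i_def)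
    have ik: "i < ?k"
    proof -
      have "x * real ?k < real ?k" using x by simp
      with i show ?thesis by linarith
    qed
    have neg: "prob {..<0} = 0"
    proof -
      have "prob {0..<1} = 1" using U[of "{..<?k}"] unit_interval_eq_Union_Ik[of ?k] by simp
      then have "prob ({..<0} \<union> {0..<1}) = prob {..<0} + 1"
        using N by (subst finite_measure_Union) auto
      then show ?thesis using prob_le_1[of "{..<0} \<union> {0..<1}"] measure_nonneg[of N "{..<0}"] by linarith
    qed
    have "(\<Union>v\<in>{..<i}. Ik ?k v) \<subseteq> {..x}"
    proof safe
      fix v y assume "v < i" "y \<in> Ik ?k v"
      then have "y * real ?k < real v + 1" "real v + 1 \<le> real i" by (auto simp: Ik_iff_floor floor_eq_iff)
      then have "y * real ?k \<le> x * real ?k" using i by linarith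
      then show "y \<le> x" by simp
    qed
    then have 1: "real i / real ?k \<le> prob {..x}"
      using finite_measure_mono[of "\<Union>v\<in>{..<i}. Ik ?k v" "{..x}"] U[of "{..<i}"] ik N by auto
    have "{..x} \<subseteq> {..<0} \<union> (\<Union>v\<in>{..i}. Ik ?k v)"
    proof
      fix y assume "y \<in> {..x}"
      then have "\<lfloor>y * real ?k\<rfloor> \<le> \<lfloor>x * real ?k\<rfloor>" by (intro floor_mono mult_right_mono) auto
      then have "nat \<lfloor>y * real ?k\<rfloor> \<le> i" by (simp add: i_def)
      moreover have "y \<in> Ik ?k (nat \<lfloor>y * real ?k\<rfloor>)" if "0 \<le> y" using that by (simp add: Ik_iff_floor)
      ultimately show "y \<in> {..<0} \<union> (\<Union>v\<in>{..i}. Ik ?k v)" by (cases "0 \<le> y") auto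
    qed
    then have "prob {..x} \<le> prob ({..<0} \<union> (\<Union>v\<in>{..i}. Ik ?k v))"
      using N by (intro finite_measure_mono) auto
    also have "\<dots> \<le> prob {..<0} + prob (\<Union>v\<in>{..i}. Ik ?k v)"
      using N by (intro measure_Un_le) auto
    also have "\<dots> = (real i + 1) / real ?k"
    proof -
      have "{..i} \<subseteq> {..<?k}" using ik by auto
      from U[OF this] neg show ?thesis by (simp add: add.commute)
    qed
    finally have 2: "prob {..x} \<le> (real i + 1) / real ?k" .
    have "real i / real ?k \<le> x" "x \<le> (real i + 1) / real ?k" using i by (auto simp: field_simps)
    with 1 2 show ?thesis by (simp add: cdf_def add_divide_distrib abs_le_iff)
  qed
  have full: "cdf N x = (if x < 0 then 0 else if x < 1 then x else 1)"
    if N: "prob_space N" "sets N = sets borel"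
    and cells: "\<And>n v. v < fact n \<Longrightarrow> measure N (Ik (fact n) v) = 1 / fact n" for N x
  proof -
    interpret prob_space N by fact
    have I: "prob {0..<1} = 1"
      using cells[of 0 0] by (simp add: Ik_def)
    consider "x < 0" | "0 \<le> x" "x < 1" | "1 \<le> x" by linarith
    then show ?thesis
    proof cases
      case 1
      then have "prob ({..x} \<union> {0..<1}) = prob {..x} + 1"
        using N I by (subst finite_measure_Union) auto
      then show ?thesis
        using prob_le_1[of "{..x} \<union> {0..<1}"] measure_nonneg[of N "{..x}"] 1 unfolding cdf_def by auto
    next
      case 2
      have "\<bar>cdf N x - x\<bar> \<le> 0"
        by (rule LIMSEQ_le_const[OF inverse_fact_tendsto_0]) (use cdf[OF 2 N cells] in auto)
      then show ?thesis using 2 by simp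
    next
      case 3
      then have "prob {0..<1} \<le> prob {..x}" using N by (intro finite_measure_mono) auto
      then show ?thesis using I prob_le_1[of "{..x}"] 3 unfolding cdf_def by auto
    qed
  qed
  show ?thesis
  proof (rule cdf_unique)
    show "real_distribution M"
      using M by (auto simp: real_distribution_def real_distribution_axioms_def)
    show "real_distribution unif"
      using prob_space_unif by (auto simp: real_distribution_def real_distribution_axioms_def)
    show "cdf M = cdf unif"
      using full[OF M cells] full[OF prob_space_unif sets_unif] by (simp add: fun_eq_iff measure_unif_Ik)
  qed
qed

text \<open>Each \<open>B i\<close> contains a compact \<open>K i\<close> of almost the same
  measure. The finitely many disjoint compact sets have positive distance, so no cell of a fine grid
  meets two of them. The cells meeting \<open>K i\<close> number about \<open>q\<close>; each family
  is trimmed to at most \<open>q\<close> cells and completed to an equipartition.\<close>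

lemma equipartition_approximation:
  assumes k: "1 \<le> k" and B: "\<And>i. i < k \<Longrightarrow> B i \<in> sets borel" "\<And>i. i < k \<Longrightarrow> measure unif (B i) = 1 / real k"
    and disj: "disjoint_family_on B {..<k}" and \<epsilon>: "0 < \<epsilon>"
  shows "\<exists>n q d. fact n = q * k \<and> equipartition q k d \<and>
    measure unif (- (\<Union>i<k. B i \<inter> (\<Union>v\<in>{v\<in>{..<fact n}. d v = i}. Ik (fact n) v))) \<le> \<epsilon>"
proof -
  interpret unif: prob_space unif by (rule prob_space_unif)
  \<comment> \<open>Every class loses at most \<open>(k + 1) * \<delta>\<close>, namely
    \<open>\<delta>\<close> by passing to \<open>K i\<close> and \<open>k * \<delta>\<close> by
    trimming. Over \<open>k\<close> classes this makes \<open>\<epsilon>\<close>.\<close>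
  define \<delta> where "\<delta> = \<epsilon> / (real k * (real k + 1))"
  have \<delta>: "0 < \<delta>" using k \<epsilon> by (simp add: \<delta>_def)
  have "\<exists>K. compact K \<and> K \<subseteq> B i \<and> 1 / real k - \<delta> < measure unif K" if i: "i < k" for i
  proof -
    have "emeasure unif (B i) = (SUP K \<in> {K. K \<subseteq> B i \<and> compact K}. emeasure unif K)"
      using B(1)[OF i] by (intro inner_regular) auto
    moreover have "ennreal (1 / real k - \<delta>) < emeasure unif (B i)"
      using \<delta> k by (simp only: unif.emeasure_eq_measure B(2)[OF i] ennreal_less_iff)
        (auto intro!: ennreal_lessI)
    ultimately obtain K where K: "K \<subseteq> B i" "compact K" "ennreal (1 / real k - \<delta>) < emeasure unif K"
      by (auto simp: less_SUP_iff)
    then have "1 / real k - \<delta> < measure unif K"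
      by (simp only: unif.emeasure_eq_measure) (metis ennreal_less_iff ennreal_neg leI measure_nonneg not_le order_less_le_trans)
    with K show ?thesis by blast
  qed
  then obtain K where K: "\<And>i. i < k \<Longrightarrow> compact (K i)" "\<And>i. i < k \<Longrightarrow> K i \<subseteq> B i"
    "\<And>i. i < k \<Longrightarrow> 1 / real k - \<delta> < measure unif (K i)" by metis
  have "\<exists>r>0. \<forall>x\<in>K i. \<forall>y\<in>K j. r \<le> dist x y" if "i < k" "j < k" "i \<noteq> j" for i j
  proof (intro separate_compact_closed compact_imp_closed)
    show "K i \<inter> K j = {}"
      using K(2)[OF that(1)] K(2)[OF that(2)] disjoint_family_onD[OF disj, of i j] that by auto
  qed (use that K(1) in auto)
  then obtain r where r: "\<And>i j. i < k \<Longrightarrow> j < k \<Longrightarrow> i \<noteq> j \<Longrightarrow> r i j > 0"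
    "\<And>i j x y. i < k \<Longrightarrow> j < k \<Longrightarrow> i \<noteq> j \<Longrightarrow> x \<in> K i \<Longrightarrow> y \<in> K j \<Longrightarrow> r i j \<le> dist x y"
    by metis
  \<comment> \<open>The element 1 keeps the set nonempty when there is no pair of distinct
    indices.\<close>
  define R where "R = Min (insert 1 (case_prod r ` {p\<in>{..<k}\<times>{..<k}. fst p \<noteq> snd p}))"
  have finR: "finite (insert 1 (case_prod r ` {p\<in>{..<k}\<times>{..<k}. fst p \<noteq> snd p}))" by simp
  have R0: "R > 0" unfolding R_def using finR by (subst Min_gr_iff) (auto intro: r)
  have R: "R \<le> dist x y" if "i < k" "j < k" "i \<noteq> j" "x \<in> K i" "y \<in> K j" for i j x y
  proof -
    have "R \<le> r i j" unfolding R_def using finR that by (intro Min_le) force+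
    with r(2) that show ?thesis by fastforce
  qed
  have "eventually (\<lambda>n. 1 / (fact n :: real) < R) sequentially"
    using order_tendstoD(2)[OF inverse_fact_tendsto_0 R0] .
  \<comment> \<open>The mesh \<open>1 / n!\<close> must be below the separation \<open>R\<close>,
    and \<open>k \<le> n\<close> makes \<open>k\<close> divide \<open>n!\<close>.\<close>
  then have "eventually (\<lambda>n. 1 / (fact n :: real) < R \<and> k \<le> n) sequentially"
    by (intro eventually_conj eventually_ge_at_top)
  then obtain n where n: "1 / (fact n :: real) < R" "k \<le> n"
    by (auto dest: eventually_happens)
  define N :: nat where "N = fact n"
  have N0: "0 < N" by (simp add: N_def)
  have "k dvd N" unfolding N_def using n k by (intro dvd_fact) auto
  then obtain q where q: "N = q * k" by (metis dvd_def mult.commute)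
  define E where "E i = {v\<in>{..<N}. Ik N v \<inter> K i \<noteq> {}}" for i
  have E_disj: "E i \<inter> E j = {}" if "i < k" "j < k" "i \<noteq> j" for i j
  proof (rule ccontr)
    assume "E i \<inter> E j \<noteq> {}"
    then obtain v x y where "x \<in> Ik N v" "y \<in> Ik N v" "x \<in> K i" "y \<in> K j" by (auto simp: E_def)
    then have "R \<le> dist x y" "dist x y < 1 / real N"
      using R that by (auto simp: Ik_def dist_real_def abs_less_iff add_divide_distrib)
    with n(1) show False by (simp add: N_def)
  qed
  define c where "c i = real (card (E i)) / real N" for i
  have U: "measure unif (\<Union>v\<in>S. Ik N v) = real (card S) / real N" if "S \<subseteq> {..<N}" for S
    using that by (intro measure_Union_Ik prob_space_unif sets_unif measure_unif_Ik)
  have fin: "finite (E i)" for i by (simp add: E_def)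
  \<comment> \<open>A set \<open>K i\<close> may contain points outside \<open>[0,1)\<close>, which
    no cell covers; they form a null set.\<close>
  have one: "measure unif (- {0..<1}) = 0"
  proof -
    have "measure unif {0..<1} = 1" using U[of "{..<N}"] unit_interval_eq_Union_Ik[OF N0] N0 by simp
    then show ?thesis using unif.prob_compl[of "{0..<1}"] by (simp add: Compl_eq_Diff_UNIV)
  qed
  have K_cover: "K i \<subseteq> - {0..<1} \<union> (\<Union>v\<in>E i. Ik N v)" for i
    using unit_interval_eq_Union_Ik[OF N0] by (auto simp: E_def)
  have c_ge: "1 / real k - \<delta> \<le> c i" if "i < k" for i
  proof -
    have "measure unif (K i) \<le> measure unif (- {0..<1} \<union> (\<Union>v\<in>E i. Ik N v))"
      using K_cover fin by (intro unif.finite_measure_mono) auto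
    also have "\<dots> \<le> measure unif (- {0..<1}) + measure unif (\<Union>v\<in>E i. Ik N v)"
      using fin by (intro measure_Un_le) auto
    also have "\<dots> = c i" using one U[of "E i"] by (auto simp: c_def E_def)
    finally show ?thesis using K(3)[OF that] by simp
  qed
  have c_sum: "(\<Sum>i<k. c i) \<le> 1"
  proof -
    have "(\<Sum>i<k. card (E i)) = card (\<Union>i<k. E i)"
      using fin E_disj by (intro card_UN_disjoint[symmetric]) auto
    also have "\<dots> \<le> card {..<N}" by (intro card_mono) (auto simp: E_def)
    finally have "real (\<Sum>i<k. card (E i)) \<le> real N" by (simp only: of_nat_le_iff card_lessThan)
    then have "(\<Sum>i<k. real (card (E i))) \<le> real N" by (simp only: of_nat_sum)
    then show ?thesis using N0 by (simp add: c_def flip: sum_divide_distrib)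
  qed
  \<comment> \<open>No class can take too many cells: the families are disjoint, and each of the
    other \<open>k - 1\<close> classes already takes a share of at least
    \<open>1 / k - \<delta>\<close>.\<close>
  have c_le: "c i \<le> 1 / real k + real k * \<delta>" if i: "i < k" for i
  proof -
    have "(\<Sum>j\<in>{..<k}-{i}. 1 / real k - \<delta>) \<le> (\<Sum>j\<in>{..<k}-{i}. c j)" using c_ge by (intro sum_mono) auto
    also have "\<dots> \<le> 1 - c i" using c_sum i by (simp add: sum_diff1)
    finally have "c i \<le> 1 - (real k - 1) * (1 / real k - \<delta>)" using i by (simp add: of_nat_diff)
    also have "\<dots> = 1 / real k + (real k - 1) * \<delta>" using k by (simp add: field_simps)
    also have "\<dots> \<le> 1 / real k + real k * \<delta>" using \<delta> by simp
    finally show ?thesis .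
  qed
  have "\<exists>E'\<subseteq>E i. card E' = min (card (E i)) q" for i
    by (metis obtain_subset_with_card_n min.cobounded1)
  then obtain E' where E': "\<And>i. E' i \<subseteq> E i" "\<And>i. card (E' i) = min (card (E i)) q" by metis
  have "\<exists>d. d \<in> {..<N} \<rightarrow> {..<k} \<and> (\<forall>i<k. card {v\<in>{..<N}. d v = i} = q) \<and> (\<forall>i<k. \<forall>v\<in>E' i. d v = i)"
  proof (rule extend_to_equipartition)
    show "disjoint_family_on E' {..<k}"
      using E_disj E'(1) unfolding disjoint_family_on_def by (metis disjoint_iff lessThan_iff subsetD)
    show "E' i \<subseteq> {..<N}" for i using E'(1)[of i] by (auto simp: E_def)
  qed (use E'(2) in \<open>auto simp: q\<close>)
  then obtain d where d: "d \<in> {..<N} \<rightarrow> {..<k}" "\<And>i. i < k \<Longrightarrow> card {v\<in>{..<N}. d v = i} = q"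
    "\<And>i v. i < k \<Longrightarrow> v \<in> E' i \<Longrightarrow> d v = i" by blast
  define C where "C i = (\<Union>v\<in>{v\<in>{..<N}. d v = i}. Ik N v)" for i
  have C_borel[measurable]: "C i \<in> sets borel" for i unfolding C_def by (intro sets.finite_UN) auto
  have BC: "1 / real k - (real k + 1) * \<delta> \<le> measure unif (B i \<inter> C i)" if i: "i < k" for i
  proof -
    \<comment> \<open>A point of \<open>K i\<close> lies in a kept cell, which \<open>d\<close>
      labels \<open>i\<close>, or in a trimmed cell, or outside \<open>[0,1)\<close>.\<close>
    have "K i \<subseteq> (B i \<inter> C i) \<union> (- {0..<1} \<union> (\<Union>v\<in>E i - E' i. Ik N v))"
    proof
      fix x assume x: "x \<in> K i"
      have "x \<in> B i" using x K(2)[OF i] by auto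
      consider "x \<in> - {0..<1}" | v where "v \<in> E i" "x \<in> Ik N v" using K_cover x by blast
      then show "x \<in> (B i \<inter> C i) \<union> (- {0..<1} \<union> (\<Union>v\<in>E i - E' i. Ik N v))"
      proof cases
        case (2 v)
        then show ?thesis
          using \<open>x \<in> B i\<close> d(3)[OF i, of v] by (cases "v \<in> E' i") (auto simp: C_def E_def)
      qed auto
    qed
    then have "measure unif (K i) \<le> measure unif ((B i \<inter> C i) \<union> (- {0..<1} \<union> (\<Union>v\<in>E i - E' i. Ik N v)))"
      using B(1)[OF i] fin by (intro unif.finite_measure_mono) auto
    also have "\<dots> \<le> measure unif (B i \<inter> C i) + measure unif (- {0..<1} \<union> (\<Union>v\<in>E i - E' i. Ik N v))"
      using B(1)[OF i] fin by (intro measure_Un_le) auto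
    also have "measure unif (- {0..<1} \<union> (\<Union>v\<in>E i - E' i. Ik N v)) \<le>
        measure unif (- {0..<1}) + measure unif (\<Union>v\<in>E i - E' i. Ik N v)"
      using fin by (intro measure_Un_le) auto
    also have "measure unif (\<Union>v\<in>E i - E' i. Ik N v) = real (card (E i - E' i)) / real N"
      by (rule U) (auto simp: E_def)
    also have "\<dots> \<le> real k * \<delta>"
    proof (cases "card (E i) \<le> q")
      case True
      then have "E' i = E i" using E'(1,2)[of i] fin by (intro card_subset_eq) auto
      then show ?thesis using \<delta> by simp
    next
      case False
      have "card (E i - E' i) = card (E i) - q"
        using False E'[of i] fin by (subst card_Diff_subset) (auto intro: finite_subset)
      then have "real (card (E i - E' i)) / real N = c i - real q / real N"
        using False by (simp add: c_def of_nat_diff diff_divide_distrib)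
      also have "real q / real N = 1 / real k" using q N0 by auto
      finally show ?thesis using c_le[OF i] by simp
    qed
    finally show ?thesis using K(3)[OF i] one by (simp add: algebra_simps)
  qed
  have "measure unif (- (\<Union>i<k. B i \<inter> C i)) = 1 - measure unif (\<Union>i<k. B i \<inter> C i)"
    using unif.prob_compl[of "\<Union>i<k. B i \<inter> C i"] B(1) by (simp add: Compl_eq_Diff_UNIV)
  also have "measure unif (\<Union>i<k. B i \<inter> C i) = (\<Sum>i<k. measure unif (B i \<inter> C i))"
  proof (rule unif.finite_measure_finite_Union)
    show "disjoint_family_on (\<lambda>i. B i \<inter> C i) {..<k}"
      using disj unfolding disjoint_family_on_def by blast
  qed (use B(1) in auto)
  also have "1 - \<dots> \<le> 1 - (\<Sum>i<k. 1 / real k - (real k + 1) * \<delta>)"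
    using BC by (intro diff_left_mono sum_mono) auto
  also have "\<dots> = \<epsilon>" using k by (simp add: right_diff_distrib \<delta>_def)
  finally have "measure unif (- (\<Union>i<k. B i \<inter> C i)) \<le> \<epsilon>" .
  moreover have "equipartition q k d" using d q by (simp add: equipartition_def)
  ultimately show ?thesis using q unfolding C_def N_def by blast
qed

subsection \<open>Expected margins\<close>

lemma finite_grid [simp]: "finite (grid k)"
  by (simp add: grid_def)

lemma measurable_entry: "c \<in> grid k \<Longrightarrow> (\<lambda>X. X c) \<in> borel_measurable (MatSpace k)"
  unfolding MatSpace_def by (rule measurable_component_singleton)

lemma consistent_Delta: "equipartition_consistent \<mu> \<Longrightarrow> 1 \<le> k \<Longrightarrow> prob_on_Delta k (\<mu> k)"
  by (simp add: equipartition_consistent_def)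

lemma consistent_rho:
  "equipartition_consistent \<mu> \<Longrightarrow> 1 \<le> k \<Longrightarrow> 1 \<le> n \<Longrightarrow> equipartition n k d \<Longrightarrow>
    distr (\<mu> (n*k)) (MatSpace k) (rho (n*k) k d) = \<mu> k"
  by (simp add: equipartition_consistent_def)

text \<open>A transposition of labels is an equipartition with fibres of size one, so consistency
  makes the law of the matrix invariant under it. Hence all \<open>k\<close> row sums have the same
  mean, and so do the column sums; the \<open>k\<close> means add up to 1. The projection
  \<open>pr\<close> selects rows or columns.\<close>

lemma expected_matrix_margin:
  assumes \<mu>: "equipartition_consistent \<mu>" and v: "v < k" and pr: "pr \<in> {fst, snd}"
  shows "(\<integral>\<^sup>+X. ennreal (\<Sum>c\<in>{c\<in>grid k. pr c = v}. X c) \<partial>\<mu> k) = ennreal (1 / real k)"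
proof -
  have k: "1 \<le> k" using v by simp
  have \<mu>k: "prob_space (\<mu> k)" and s[measurable_cong]: "sets (\<mu> k) = sets (MatSpace k)"
    using consistent_Delta[OF \<mu> k] by (auto simp: prob_on_Delta_def)
  interpret prob_space "\<mu> k" by fact
  define g where "g v X = (\<Sum>c\<in>{c\<in>grid k. pr c = v}. X c)" for v and X :: "nat \<times> nat \<Rightarrow> real"
  have g_meas[measurable]: "g v \<in> borel_measurable (MatSpace k)" for v
    unfolding g_def[abs_def] by (intro borel_measurable_sum measurable_entry) auto
  define a where "a v = (\<integral>\<^sup>+X. ennreal (g v X) \<partial>\<mu> k)" for v
  have symm: "a u = a v" if u: "u < k" for u
  proof -
    let ?t = "Transposition.transpose u v"
    have inv: "?t (?t x) = x" for x by simp
    have tk: "?t x < k \<longleftrightarrow> x < k" for x using u v by (auto simp: Transposition.transpose_def)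
    have fiber: "{x\<in>{..<k}. ?t x = i} = {?t i}" if "i < k" for i
    proof -
      have "x < k \<and> ?t x = i \<longleftrightarrow> x = ?t i" for x
        using inv[of x] inv[of i] tk[of x] that by metis
      then show ?thesis by auto
    qed
    have eq: "equipartition 1 k ?t"
      unfolding equipartition_def using fiber tk by auto
    have entry: "rho k k ?t X c = X (?t (fst c), ?t (snd c))" if "c \<in> grid k" for X c
      using that by (simp add: rho_def grid_def fiber[simplified] mem_Times_iff)
    have "g u (rho k k ?t X) = g v X" for X
    proof -
      have "g u (rho k k ?t X) = (\<Sum>c\<in>{c\<in>grid k. pr c = u}. X (?t (fst c), ?t (snd c)))"
        unfolding g_def by (intro sum.cong refl entry) simp
      also have "\<dots> = (\<Sum>c\<in>{c\<in>grid k. pr c = v}. X c)"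
      proof -
        \<comment> \<open>The swap applied to both indices of an entry; as an involution of the grid
          it is its own inverse in the reindexing of row \<open>u\<close> by row
          \<open>v\<close>.\<close>
        define T where "T c = (?t (fst c), ?t (snd c))" for c
        have T1: "T (T c) = c" for c by (simp add: T_def)
        have T2: "T c \<in> grid k \<longleftrightarrow> c \<in> grid k" for c by (simp add: T_def grid_def mem_Times_iff tk)
        have T3: "pr (T c) = ?t (pr c)" for c using pr by (elim insertE) (simp_all add: T_def)
        show ?thesis unfolding T_def[symmetric]
          by (rule sum.reindex_bij_witness[where i = T and j = T]) (simp_all add: T1 T2 T3)
      qed
      finally show ?thesis by (simp add: g_def)
    qed
    then have "a v = (\<integral>\<^sup>+X. ennreal (g u (rho k k ?t X)) \<partial>\<mu> k)" by (simp add: a_def)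
    also have "\<dots> = (\<integral>\<^sup>+X. ennreal (g u X) \<partial>distr (\<mu> k) (MatSpace k) (rho k k ?t))"
      by (subst nn_integral_distr) auto
    also have "distr (\<mu> k) (MatSpace k) (rho k k ?t) = \<mu> k"
      using consistent_rho[OF \<mu> k _ eq] by simp
    finally show ?thesis by (simp add: a_def)
  qed
  have "(\<Sum>u<k. a u) = (\<integral>\<^sup>+X. (\<Sum>u<k. ennreal (g u X)) \<partial>\<mu> k)"
    unfolding a_def by (rule nn_integral_sum[symmetric]) measurable
  also have "\<dots> = (\<integral>\<^sup>+X. 1 \<partial>\<mu> k)"
  proof (rule nn_integral_cong_AE)
    show "AE X in \<mu> k. (\<Sum>u<k. ennreal (g u X)) = 1"
      using AE_Delta[OF consistent_Delta[OF \<mu> k]]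
    proof eventually_elim
      case (elim X)
      then have "(\<Sum>u<k. ennreal (g u X)) = ennreal (\<Sum>u<k. g u X)"
        by (intro sum_ennreal) (auto simp: g_def Delta_def intro!: sum_nonneg)
      also have "(\<Sum>u<k. g u X) = (\<Sum>c\<in>grid k. X c)"
        unfolding g_def using pr by (intro sum.group) (auto simp: grid_def)
      finally show ?case using elim by (simp add: Delta_def)
    qed
  qed
  also have "\<dots> = 1" by (simp add: emeasure_space_1)
  finally have sum1: "(\<Sum>u<k. a u) = 1" .
  have "(\<Sum>u<k. a u) = (\<Sum>u<k. a v)" using symm by (intro sum.cong) auto
  then have ka: "of_nat k * a v = 1" using sum1 by simp
  show ?thesis
  proof (cases "a v")
    case (real r)
    then have "ennreal (real k * r) = 1" using ka by (simp add: ennreal_mult ennreal_of_nat_eq_real_of_nat)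
    then have "real k * r = 1" by simp
    then have "r = 1 / real k" using k by (simp add: field_simps)
    then show ?thesis using real by (simp add: a_def g_def)
  next
    case top
    then show ?thesis using ka k by (simp add: ennreal_mult_top)
  qed
qed

text \<open>The strip reaches up to the edge where the other coordinate is 1, whereas the cells of a
  row or column stop short of it; concentration closes the gap. \<open>pr\<close> projects points
  and \<open>prn\<close> projects indices, two instances of the same projection.\<close>

lemma strip_measure_eq_margin:
  assumes M: "prob_space M" "sets M = sets Sq" and conc: "measure M ({0..<1} \<times> {0..<1}) = 1"
    and v: "v < k" and pr: "pr = fst \<and> prn = fst \<or> pr = snd \<and> prn = snd"
  shows "measure M (pr -` Ik k v \<inter> space M) = (\<Sum>c\<in>{c\<in>grid k. prn c = v}. Gk k M c)"
proof -
  interpret prob_space M by fact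
  have sp: "space M = {0..1} \<times> {0..1}" using sets_eq_imp_space_eq[OF M(2)] by (simp add: space_Sq)
  have k: "0 < k" using v by simp
  have Iv: "Ik k v \<subseteq> {0..<1}" by (rule Ik_subset_unit[OF v])
  have U: "{0..<1} = (\<Union>u\<in>{..<k}. Ik k u)" "Ik k v = (\<Union>u\<in>{v}. Ik k u)"
    using unit_interval_eq_Union_Ik[OF k] by auto
  have ev: "A \<times> B \<in> events" if "A \<in> sets borel" "B \<in> sets borel" "A \<subseteq> {0..1}" "B \<subseteq> {0..1}" for A B
    unfolding M using that by (rule Times_in_sets_Sq)
  have "AE x in M. x \<in> {0..<1} \<times> {0..<1}"
    using conc by (subst prob_eq_1[symmetric]) (auto intro!: ev)
  then have red: "measure M A = measure M B" if "A \<in> events" "B \<in> events" "A \<inter> {0..<1}\<times>{0..<1} = B" for A B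
    using that by (intro finite_measure_eq_AE) (auto elim!: eventually_mono)
  from pr show ?thesis
  proof
    assume [simp]: "pr = fst \<and> prn = fst"
    have "pr -` Ik k v \<inter> space M = Ik k v \<times> {0..1}" using Iv by (force simp: sp)
    also have "measure M \<dots> = measure M (Ik k v \<times> {0..<1})"
      using Iv by (intro red ev) auto
    also have "\<dots> = (\<Sum>v'\<in>{v}. \<Sum>u<k. measure M (Ik k v' \<times> Ik k u))"
      unfolding U(1) by (subst (1) U(2)) (rule measure_Union_cells[OF M], use v in auto)
    also have "\<dots> = (\<Sum>u<k. Gk k M (v, u))" using v by (simp add: Gk_def grid_def)
    also have "\<dots> = (\<Sum>c\<in>{c\<in>grid k. prn c = v}. Gk k M c)"
      by (rule sum.reindex_bij_witness[where i = snd and j = "Pair v"]) (use v in \<open>auto simp: grid_def\<close>)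
    finally show ?thesis .
  next
    assume [simp]: "pr = snd \<and> prn = snd"
    have "pr -` Ik k v \<inter> space M = {0..1} \<times> Ik k v" using Iv by (force simp: sp)
    also have "measure M \<dots> = measure M ({0..<1} \<times> Ik k v)"
      using Iv by (intro red ev) auto
    also have "\<dots> = (\<Sum>u<k. \<Sum>v'\<in>{v}. measure M (Ik k u \<times> Ik k v'))"
      unfolding U(1) by (subst (1) U(2)) (rule measure_Union_cells[OF M], use v in auto)
    also have "\<dots> = (\<Sum>u<k. Gk k M (u, v))" using v by (simp add: Gk_def grid_def)
    also have "\<dots> = (\<Sum>c\<in>{c\<in>grid k. prn c = v}. Gk k M c)"
      by (rule sum.reindex_bij_witness[where i = fst and j = "\<lambda>u. (u, v)"]) (use v in \<open>auto simp: grid_def\<close>)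
    finally show ?thesis .
  qed
qed

lemma measurable_proj_Sq: "pr \<in> {fst, snd} \<Longrightarrow> pr \<in> measurable Sq (borel :: real measure)"
  unfolding Sq_def by (intro measurable_restrict_space1) (auto simp flip: borel_prod)

text \<open>The mean margin is formed as a genuine measure, the Giry bind \<open>\<beta>\<close>. It
  then suffices to identify its masses on cells, and the result holds for all Borel sets, in
  particular for the exceptional sets of an approximation.\<close>

lemma expected_margin_unif:
  assumes \<mu>: "equipartition_consistent \<mu>" and P: "prob_space P" "sets P = sets (prob_algebra Sq)"
    and law: "\<And>n. distr P (MatSpace (fact n)) (Gk (fact n)) = \<mu> (fact n)"
    and pr: "pr \<in> {fst, snd}" and B: "B \<in> sets borel"
  shows "(\<integral>\<^sup>+m. emeasure m (pr -` B \<inter> space m) \<partial>P) = emeasure unif B"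
proof -
  interpret prob_space P by fact
  have pr_meas: "pr \<in> measurable Sq borel" using measurable_proj_Sq[OF pr] .
  define prn :: "nat \<times> nat \<Rightarrow> nat" where "prn = (if pr = fst then fst else snd)"
  have prn: "pr = fst \<and> prn = fst \<or> pr = snd \<and> prn = snd" "prn \<in> {fst, snd}"
    using pr by (auto simp: prn_def)
  have spP: "m \<in> space (prob_algebra Sq)" if "m \<in> space P" for m
    using that sets_eq_imp_space_eq[OF P(2)] by simp
  have K: "(\<lambda>m. distr m borel pr) \<in> measurable P (prob_algebra borel)"
    using measurable_distr_prob_space[OF pr_meas] by (simp cong: measurable_cong_sets add: P)
  define \<beta> where "\<beta> = P \<bind> (\<lambda>m. distr m borel pr)"
  have em: "emeasure \<beta> A = (\<integral>\<^sup>+m. emeasure m (pr -` A \<inter> space m) \<partial>P)" if A: "A \<in> sets borel" for A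
  proof -
    have "emeasure \<beta> A = (\<integral>\<^sup>+m. emeasure (distr m borel pr) A \<partial>P)"
      unfolding \<beta>_def by (rule emeasure_bind[OF not_empty measurable_prob_algebraD[OF K] A])
    also have "\<dots> = (\<integral>\<^sup>+m. emeasure m (pr -` A \<inter> space m) \<partial>P)"
    proof (rule nn_integral_cong)
      fix m assume "m \<in> space P"
      then have "pr \<in> measurable m borel"
        using pr_meas spP by (auto simp: space_prob_algebra cong: measurable_cong_sets)
      then show "emeasure (distr m borel pr) A = emeasure m (pr -` A \<inter> space m)"
        using A by (rule emeasure_distr)
    qed
    finally show ?thesis .
  qed
  have sets_\<beta>: "sets \<beta> = sets borel"
    unfolding \<beta>_def using not_empty by (intro sets_bind) auto
  have sp1: "emeasure \<beta> (space \<beta>) = 1"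
  proof -
    have "emeasure m (pr -` UNIV \<inter> space m) = 1" if "m \<in> space P" for m
      using spP[OF that] by (simp add: space_prob_algebra prob_space.emeasure_space_1)
    then have "emeasure \<beta> UNIV = (\<integral>\<^sup>+m. 1 \<partial>P)"
      by (subst em) (auto intro!: nn_integral_cong simp del: vimage_UNIV nn_integral_const)
    then show ?thesis using sets_eq_imp_space_eq[OF sets_\<beta>] by (simp add: emeasure_space_1)
  qed
  then have prob_\<beta>: "prob_space \<beta>" by (rule prob_spaceI)
  have "distr P (MatSpace 1) (Gk 1) = \<mu> 1" using law[of 0] by simp
  then have conc: "AE m in P. measure m ({0..<1} \<times> {0..<1}) = 1"
    using consistent_Delta[OF \<mu>, of 1] by (intro AE_concentrated P) simp
  have "\<beta> = unif"
  proof (rule eq_unif_if_cells[OF prob_\<beta> sets_\<beta>])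
    fix n v :: nat assume v: "v < fact n"
    let ?k = "fact n :: nat"
    have Gm: "Gk ?k \<in> measurable P (MatSpace ?k)"
      using measurable_Gk by (simp cong: measurable_cong_sets add: P)
    have "emeasure \<beta> (Ik ?k v) = (\<integral>\<^sup>+m. emeasure m (pr -` Ik ?k v \<inter> space m) \<partial>P)" by (simp add: em)
    also have "\<dots> = (\<integral>\<^sup>+m. ennreal (\<Sum>c\<in>{c\<in>grid ?k. prn c = v}. Gk ?k m c) \<partial>P)"
    proof (rule nn_integral_cong_AE)
      show "AE m in P. emeasure m (pr -` Ik ?k v \<inter> space m) = ennreal (\<Sum>c\<in>{c\<in>grid ?k. prn c = v}. Gk ?k m c)"
        using conc AE_space
      proof eventually_elim
        case (elim m)
        then have m: "prob_space m" "sets m = sets Sq" using spP by (auto simp: space_prob_algebra)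
        interpret m: prob_space m by fact
        show ?case
          using strip_measure_eq_margin[OF m elim(1) v prn(1)] by (simp add: m.emeasure_eq_measure)
      qed
    qed
    also have "\<dots> = (\<integral>\<^sup>+X. ennreal (\<Sum>c\<in>{c\<in>grid ?k. prn c = v}. X c) \<partial>distr P (MatSpace ?k) (Gk ?k))"
      by (subst nn_integral_distr[OF Gm])
        (auto intro!: measurable_compose[OF _ measurable_ennreal] borel_measurable_sum measurable_entry)
    also have "\<dots> = ennreal (1 / real ?k)"
      unfolding law by (rule expected_matrix_margin[OF \<mu> v prn(2)])
    finally show "measure \<beta> (Ik ?k v) = 1 / fact n" by (simp add: measure_def)
  qed
  then show ?thesis using em[OF B] by simp
qed

section \<open>Matrices of measurable partitions and exchangeability\<close>

text \<open>Replacing each \<open>B i\<close> by the union \<open>C i\<close> of the cells with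
  label \<open>i\<close> turns the matrix into \<open>rho\<close> of a cell matrix, whose law is
  exactly \<open>\<mu> k\<close> by consistency. The two matrices differ entrywise by at most the
  mass of the two strips over the set \<open>D\<close> where the partitions disagree, and the mean
  mass of each strip is the measure of \<open>D\<close>.\<close>

lemma law_of_partition_matrix:
  assumes \<mu>: "equipartition_consistent \<mu>" and P: "prob_space P" "sets P = sets (prob_algebra Sq)"
    and law: "\<And>n. distr P (MatSpace (fact n)) (Gk (fact n)) = \<mu> (fact n)"
    and k: "1 \<le> k" and B: "\<And>i. i < k \<Longrightarrow> B i \<in> sets borel" "\<And>i. i < k \<Longrightarrow> B i \<subseteq> {0..1}"
      "\<And>i. i < k \<Longrightarrow> measure unif (B i) = 1 / real k"
    and disj: "disjoint_family_on B {..<k}"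
  shows "distr P (MatSpace k) (\<lambda>m. \<lambda>p\<in>grid k. measure m (B (fst p) \<times> B (snd p))) = \<mu> k"
  unfolding MatSpace_def
proof (rule distr_eq_of_approx_in_prob[OF finite_grid P(1)])
  interpret prob_space P by fact
  let ?Y = "\<lambda>m. \<lambda>p\<in>grid k. measure m (B (fst p) \<times> B (snd p))"
  have meas_P: "(\<lambda>m. measure m A) \<in> borel_measurable P" if "A \<in> sets Sq" for A
    using measurable_measure_prob_algebra[OF that] by (simp cong: measurable_cong_sets add: P)
  have B_sets: "B i \<times> B j \<in> sets Sq" if "i < k" "j < k" for i j
    using that B by (intro Times_in_sets_Sq) auto
  show "?Y \<in> measurable P (PiM (grid k) (\<lambda>_. borel))"
    using B_sets by (intro measurable_restrict meas_P) (auto simp: grid_def)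
  have spP: "prob_space m \<and> sets m = sets Sq" if "m \<in> space P" for m
    using that sets_eq_imp_space_eq[OF P(2)] by (simp add: space_prob_algebra)
  fix \<eta> \<epsilon> :: real assume \<eta>: "0 < \<eta>" and \<epsilon>: "0 < \<epsilon>"
  \<comment> \<open>Two strips of mean mass at most \<open>\<delta>\<close> give a mean error of at
    most \<open>\<epsilon> * \<eta>\<close>, and Markov's inequality at level \<open>\<eta>\<close>
    leaves \<open>\<epsilon>\<close>.\<close>
  define \<delta> where "\<delta> = \<epsilon> * \<eta> / 2"
  have \<delta>: "0 < \<delta>" using \<eta> \<epsilon> by (simp add: \<delta>_def)
  obtain n q d where q: "fact n = q * k" and d: "equipartition q k d" and
    small: "measure unif (- (\<Union>i<k. B i \<inter> (\<Union>v\<in>{v\<in>{..<fact n}. d v = i}. Ik (fact n) v))) \<le> \<delta>"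
    using equipartition_approximation[OF k B(1,3) disj \<delta>] by blast
  define N :: nat where "N = fact n"
  have N0: "0 < N" by (simp add: N_def)
  define C where "C i = (\<Union>v\<in>{v\<in>{..<N}. d v = i}. Ik N v)" for i
  define D where "D = - (\<Union>i<k. B i \<inter> C i)"
  have C_borel: "C i \<in> sets borel" for i unfolding C_def by (intro sets.finite_UN) auto
  have C_unit: "C i \<subseteq> {0..1}" for i using Ik_subset_unit[of _ N] unfolding C_def by fastforce
  have C_disj: "C i \<inter> C j = {}" if "i \<noteq> j" for i j
  proof -
    have False if "x \<in> Ik N v" "x \<in> Ik N u" "d v = i" "d u = j" for x v u
      using that disjoint_Ik[OF N0, of v u] \<open>i \<noteq> j\<close> by (cases "v = u") auto
    then show ?thesis unfolding C_def by blast
  qed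
  have D_borel: "D \<in> sets borel" unfolding D_def using B(1) C_borel by (intro borel_comp sets.finite_UN) auto
  \<comment> \<open>Off \<open>D\<close> a point belongs to \<open>B j\<close> and
    \<open>C j\<close> for a common \<open>j\<close>. Both families are disjoint, so it belongs to
    no other member of either.\<close>
  have BC: "x \<in> B i \<longleftrightarrow> x \<in> C i" if xD: "x \<notin> D" and "i < k" for x i
  proof -
    obtain j where j: "j < k" "x \<in> B j" "x \<in> C j" using xD by (auto simp: D_def)
    have "B i \<inter> B j = {}" "C i \<inter> C j = {}" if "i \<noteq> j"
      using disjoint_family_onD[OF disj, of i j] C_disj that \<open>i < k\<close> j(1) by auto
    then show ?thesis using j by (cases "i = j") auto
  qed
  define Dst where "Dst pr = pr -` D \<inter> space Sq" for pr :: "real \<times> real \<Rightarrow> real"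
  have Dst_sets: "Dst pr \<in> sets Sq" if "pr \<in> {fst, snd}" for pr
    unfolding Dst_def by (rule measurable_sets[OF measurable_proj_Sq[OF that] D_borel])
  define R where "R m = measure m (Dst fst) + measure m (Dst snd)" for m
  have R_meas: "R \<in> borel_measurable P"
    unfolding R_def[abs_def] using Dst_sets by (intro borel_measurable_add meas_P) auto
  let ?Z = "\<lambda>m. rho N k d (Gk N m)"
  have Gm: "Gk N \<in> measurable P (MatSpace N)"
    using measurable_Gk by (simp cong: measurable_cong_sets add: P)
  have Z_meas: "?Z \<in> measurable P (MatSpace k)"
    by (rule measurable_compose[OF Gm measurable_rho])
  have "distr P (MatSpace k) ?Z = distr (distr P (MatSpace N) (Gk N)) (MatSpace k) (rho N k d)"
    by (subst distr_distr[OF measurable_rho Gm]) (simp add: comp_def)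
  also have "\<dots> = distr (\<mu> (q*k)) (MatSpace k) (rho (q*k) k d)"
    using law[of n] q by (simp add: N_def)
  also have "\<dots> = \<mu> k"
    using q d k by (intro consistent_rho[OF \<mu>]) (auto intro: Nat.gr0I simp: Suc_le_eq)
  finally have Z_law: "distr P (MatSpace k) ?Z = \<mu> k" .
  have YZ: "\<bar>?Y m p - ?Z m p\<bar> \<le> R m" if m: "m \<in> space P" and p: "p \<in> grid k" for m p
  proof -
    interpret m: prob_space m using spP[OF m] by simp
    have sm: "sets m = sets Sq" using spP[OF m] by simp
    obtain i j where ij: "p = (i, j)" "i < k" "j < k" using p by (auto simp: grid_def)
    have Zp: "?Z m p = measure m (C i \<times> C j)"
      using rho_Gk[OF m.prob_space_axioms sm p, of N d] by (simp add: C_def ij)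
    have close: "measure m X \<le> measure m Y + R m"
      if "X \<in> sets Sq" "Y \<in> sets Sq" "X \<subseteq> Y \<union> (Dst fst \<union> Dst snd)" for X Y
    proof -
      have "measure m X \<le> measure m (Y \<union> (Dst fst \<union> Dst snd))"
        using that Dst_sets sm by (intro m.finite_measure_mono) auto
      also have "\<dots> \<le> measure m Y + measure m (Dst fst \<union> Dst snd)"
        using that Dst_sets sm by (intro measure_Un_le) auto
      also have "measure m (Dst fst \<union> Dst snd) \<le> R m"
        unfolding R_def using Dst_sets sm by (intro measure_Un_le) auto
      finally show ?thesis by simp
    qed
    have CS: "C i \<times> C j \<in> sets Sq" by (intro Times_in_sets_Sq C_borel C_unit)
    have BS: "B i \<times> B j \<in> sets Sq" using ij by (intro B_sets)
    have sub: "X \<times> Y \<subseteq> X' \<times> Y' \<union> (Dst fst \<union> Dst snd)"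
      if "X \<subseteq> {0..1}" "Y \<subseteq> {0..1}" "\<And>x. x \<notin> D \<Longrightarrow> x \<in> X \<Longrightarrow> x \<in> X'" "\<And>y. y \<notin> D \<Longrightarrow> y \<in> Y \<Longrightarrow> y \<in> Y'"
      for X Y X' Y'
    proof
      fix z assume "z \<in> X \<times> Y"
      then obtain x y where z: "z = (x, y)" "x \<in> X" "y \<in> Y" by auto
      have "x \<in> D \<Longrightarrow> z \<in> Dst fst" "y \<in> D \<Longrightarrow> z \<in> Dst snd"
        using z that(1,2) by (auto simp: Dst_def space_Sq)
      then show "z \<in> X' \<times> Y' \<union> (Dst fst \<union> Dst snd)" using z that(3,4) by blast
    qed
    have 1: "B i \<times> B j \<subseteq> C i \<times> C j \<union> (Dst fst \<union> Dst snd)"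
      using ij B(2) BC by (intro sub) auto
    have 2: "C i \<times> C j \<subseteq> B i \<times> B j \<union> (Dst fst \<union> Dst snd)"
      using ij C_unit BC by (intro sub) auto
    show ?thesis using close[OF BS CS 1] close[OF CS BS 2] Zp p ij by simp
  qed
  have margin: "(\<integral>\<^sup>+m. ennreal (measure m (Dst pr)) \<partial>P) \<le> ennreal \<delta>" if pr: "pr \<in> {fst, snd}" for pr
  proof -
    have "(\<integral>\<^sup>+m. ennreal (measure m (Dst pr)) \<partial>P) = (\<integral>\<^sup>+m. emeasure m (pr -` D \<inter> space m) \<partial>P)"
    proof (rule nn_integral_cong)
      fix m assume "m \<in> space P"
      then interpret m: prob_space m using spP by simp
      have "space m = space Sq" using spP[OF \<open>m \<in> space P\<close>] by (auto dest: sets_eq_imp_space_eq)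
      then show "ennreal (measure m (Dst pr)) = emeasure m (pr -` D \<inter> space m)"
        by (simp add: Dst_def m.emeasure_eq_measure)
    qed
    also have "\<dots> = emeasure unif D" by (rule expected_margin_unif[OF \<mu> P law pr D_borel])
    also have "\<dots> \<le> ennreal \<delta>"
      using small prob_space.finite_measure[OF prob_space_unif, THEN finite_measure.emeasure_eq_measure, of D]
      by (simp add: D_def C_def N_def ennreal_leI)
    finally show ?thesis .
  qed
  have ER: "(\<integral>\<^sup>+m. ennreal (R m) \<partial>P) \<le> ennreal (2 * \<delta>)"
  proof -
    have "(\<integral>\<^sup>+m. ennreal (R m) \<partial>P) = (\<integral>\<^sup>+m. ennreal (measure m (Dst fst)) \<partial>P) + (\<integral>\<^sup>+m. ennreal (measure m (Dst snd)) \<partial>P)"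
      unfolding R_def using Dst_sets meas_P by (subst nn_integral_add[symmetric]) (auto simp: ennreal_plus)
    also have "\<dots> \<le> ennreal \<delta> + ennreal \<delta>" by (intro add_mono margin) auto
    finally show ?thesis using \<delta> by (simp flip: ennreal_plus)
  qed
  have "emeasure P {m\<in>space P. \<exists>p\<in>grid k. \<eta> \<le> \<bar>?Y m p - ?Z m p\<bar>} \<le> emeasure P {m\<in>space P. 1 \<le> ennreal (1 / \<eta>) * ennreal (R m)}"
  proof (rule emeasure_mono)
    show "{m\<in>space P. \<exists>p\<in>grid k. \<eta> \<le> \<bar>?Y m p - ?Z m p\<bar>} \<subseteq> {m\<in>space P. 1 \<le> ennreal (1 / \<eta>) * ennreal (R m)}"
    proof safe
      fix m p assume m: "m \<in> space P" and p: "p \<in> grid k" and le: "\<eta> \<le> \<bar>?Y m p - ?Z m p\<bar>"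
      have "\<eta> \<le> R m" using YZ[OF m p] le by linarith
      then have "1 \<le> 1 / \<eta> * R m" using \<eta> by (simp add: field_simps)
      then show "1 \<le> ennreal (1 / \<eta>) * ennreal (R m)"
        using \<eta> by (subst ennreal_mult'[symmetric]) (auto simp flip: ennreal_1 intro!: ennreal_leI)
    qed
  qed (use R_meas in measurable)
  also have "\<dots> \<le> ennreal (1 / \<eta>) * (\<integral>\<^sup>+m. ennreal (R m) * indicator (space P) m \<partial>P)"
    using R_meas by (intro nn_integral_Markov_inequality) auto
  also have "(\<integral>\<^sup>+m. ennreal (R m) * indicator (space P) m \<partial>P) = (\<integral>\<^sup>+m. ennreal (R m) \<partial>P)"
    by (intro nn_integral_cong) auto
  also have "ennreal (1 / \<eta>) * \<dots> \<le> ennreal (1 / \<eta>) * ennreal (2 * \<delta>)"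
    using ER by (rule mult_left_mono) simp
  also have "\<dots> = ennreal \<epsilon>" using \<eta> by (subst ennreal_mult'[symmetric]) (auto simp: \<delta>_def)
  finally have "prob {m\<in>space P. \<exists>p\<in>grid k. \<eta> \<le> \<bar>?Y m p - ?Z m p\<bar>} \<le> \<epsilon>"
    using \<epsilon> by (simp only: emeasure_eq_measure ennreal_le_iff less_imp_le)
  then show "\<exists>Z\<in>measurable P (PiM (grid k) (\<lambda>_. borel)). distr P (PiM (grid k) (\<lambda>_. borel)) Z = \<mu> k \<and>
      prob {m\<in>space P. \<exists>p\<in>grid k. \<eta> \<le> \<bar>?Y m p - Z m p\<bar>} \<le> \<epsilon>"
    using Z_meas Z_law unfolding MatSpace_def by blast
qed

lemma law_of_Gk:
  assumes \<mu>: "equipartition_consistent \<mu>" and P: "prob_space P" "sets P = sets (prob_algebra Sq)"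
    and law: "\<And>n. distr P (MatSpace (fact n)) (Gk (fact n)) = \<mu> (fact n)" and k: "1 \<le> k"
  shows "distr P (MatSpace k) (Gk k) = \<mu> k"
proof -
  have "disjoint_family_on (Ik k) {..<k}"
    using k by (auto simp: disjoint_family_on_def disjoint_Ik)
  moreover have "Ik k i \<subseteq> {0..1}" if "i < k" for i using Ik_subset_unit[OF that] by force
  ultimately have "distr P (MatSpace k) (\<lambda>m. \<lambda>p\<in>grid k. measure m (Ik k (fst p) \<times> Ik k (snd p))) = \<mu> k"
    by (intro law_of_partition_matrix[OF \<mu> P law k]) (auto simp: measure_unif_Ik)
  then show ?thesis by (simp add: Gk_def[abs_def])
qed

text \<open>The cell matrix of the pushed-forward measure is the matrix of the original one for the
  partition into preimages of the intervals. These are Borel sets of measure \<open>1 / k\<close>,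
  so both random measures have the same matrix laws at all factorial levels, and these determine the
  law.\<close>

lemma exchangeable_if_Gk_laws:
  assumes \<mu>: "equipartition_consistent \<mu>" and P: "prob_space P" "sets P = sets (prob_algebra Sq)"
    and law: "\<And>n. distr P (MatSpace (fact n)) (Gk (fact n)) = \<mu> (fact n)"
  shows "exchangeable_law P"
  unfolding exchangeable_law_def
proof (intro allI impI)
  fix \<sigma> assume "mp_bij \<sigma>"
  then have \<sigma>: "\<sigma> \<in> measurable Leb01 Leb01" "distr Leb01 Leb01 \<sigma> = Leb01" by (auto simp: mp_bij_def)
  interpret prob_space P by fact
  \<comment> \<open>\<open>Leb01\<close> carries the Borel sets of the interval, so \<sigma> is
    Borel measurable and acts on Borel measures of the square.\<close>
  have sets_Leb: "sets Leb01 = sets (restrict_space borel {0..1})"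
    unfolding Leb01_def by (intro sets_restrict_space_cong) simp
  have space_Leb: "space Leb01 = {0..1}" by (simp add: Leb01_def space_restrict_space)
  define T where "T = (\<lambda>(x, y). (\<sigma> x, \<sigma> y))"
  have T: "T \<in> measurable Sq Sq"
  proof -
    have "(\<lambda>z. \<sigma> (pr z)) \<in> borel_measurable Sq" and "(\<lambda>z. \<sigma> (pr z)) \<in> space Sq \<rightarrow> {0..1}"
      if pr: "pr \<in> {fst, snd}" for pr
    proof -
      have "pr \<in> measurable Sq (restrict_space borel {0..1})"
        using measurable_proj_Sq[OF pr] pr by (intro measurable_restrict_space2) (auto simp: space_Sq)
      then have "pr \<in> measurable Sq Leb01" by (simp cong: measurable_cong_sets add: sets_Leb)
      from measurable_compose[OF this \<sigma>(1)]
      have "(\<lambda>z. \<sigma> (pr z)) \<in> measurable Sq (restrict_space borel {0..1})"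
        by (simp cong: measurable_cong_sets add: sets_Leb)
      then show "(\<lambda>z. \<sigma> (pr z)) \<in> borel_measurable Sq" "(\<lambda>z. \<sigma> (pr z)) \<in> space Sq \<rightarrow> {0..1}"
        by (simp_all add: measurable_restrict_space2_iff)
    qed
    from this[of fst] this[of snd] have "(\<lambda>z. (\<sigma> (fst z), \<sigma> (snd z))) \<in> measurable Sq Sq"
      by (subst (2) Sq_def, intro measurable_restrict_space2) (auto simp flip: borel_prod)
    then show ?thesis by (simp add: T_def case_prod_beta')
  qed
  have pushP: "(\<lambda>m. distr m Sq T) \<in> measurable P (prob_algebra Sq)"
    using measurable_distr_prob_space[OF T] by (simp cong: measurable_cong_sets add: P)
  define Q where "Q = distr P (prob_algebra Sq) (\<lambda>m. distr m Sq T)"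
  have Q: "prob_space Q" "sets Q = sets (prob_algebra Sq)"
    unfolding Q_def using prob_space_distr[OF pushP] by auto
  have lawQ: "distr Q (MatSpace (fact n)) (Gk (fact n)) = \<mu> (fact n)" for n
  proof -
    let ?k = "fact n :: nat"
    define B where "B i = \<sigma> -` Ik ?k i \<inter> {0..1}" for i
    have Ik_Leb: "Ik ?k i \<in> sets Leb01" if "i < ?k" for i
      using Ik_subset_unit[OF that] unfolding sets_Leb by (subst sets_restrict_space_iff) force+
    have B_Leb: "B i \<in> sets Leb01" if "i < ?k" for i
      using measurable_sets[OF \<sigma>(1) Ik_Leb[OF that]] by (simp add: B_def space_Leb)
    have B_borel: "B i \<in> sets borel" if "i < ?k" for i
      using B_Leb[OF that] unfolding sets_Leb by (simp add: sets_restrict_space_iff)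
    have em_Leb: "emeasure unif A = emeasure Leb01 A" if "A \<in> sets borel" "A \<subseteq> {0..1}" for A
      using that by (simp add: emeasure_unif Leb01_def emeasure_restrict_space Int_absorb1)
    have "emeasure unif (B i) = emeasure unif (Ik ?k i)" if i: "i < ?k" for i
    proof -
      have "emeasure unif (B i) = emeasure Leb01 (\<sigma> -` Ik ?k i \<inter> space Leb01)"
        using B_borel[OF i] by (subst em_Leb) (auto simp: B_def space_Leb)
      also have "\<dots> = emeasure (distr Leb01 Leb01 \<sigma>) (Ik ?k i)"
        by (rule emeasure_distr[OF \<sigma>(1) Ik_Leb[OF i], symmetric])
      also have "\<dots> = emeasure unif (Ik ?k i)"
        unfolding \<sigma>(2) using Ik_subset_unit[OF i] by (intro em_Leb[symmetric]) force+
      finally show ?thesis .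
    qed
    then have B_unif: "measure unif (B i) = 1 / real ?k" if "i < ?k" for i
      using that measure_unif_Ik[OF that] by (simp add: measure_def)
    have "disjoint_family_on B {..<?k}"
      using disjoint_Ik[of ?k] unfolding disjoint_family_on_def B_def by fastforce
    moreover have "B i \<subseteq> {0..1}" for i by (simp add: B_def)
    ultimately have law': "distr P (MatSpace ?k) (\<lambda>m. \<lambda>p\<in>grid ?k. measure m (B (fst p) \<times> B (snd p))) = \<mu> ?k"
      using B_borel B_unif by (intro law_of_partition_matrix[OF \<mu> P law]) auto
    have "distr Q (MatSpace ?k) (Gk ?k) = distr P (MatSpace ?k) (\<lambda>m. Gk ?k (distr m Sq T))"
      unfolding Q_def by (subst distr_distr[OF measurable_Gk pushP]) (simp add: comp_def)
    also have "\<dots> = distr P (MatSpace ?k) (\<lambda>m. \<lambda>p\<in>grid ?k. measure m (B (fst p) \<times> B (snd p)))"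
    proof (intro distr_cong refl)
      fix m assume "m \<in> space P"
      then have m: "sets m = sets Sq"
        using sets_eq_imp_space_eq[OF P(2)] by (simp add: space_prob_algebra)
      have Tm: "T \<in> measurable m Sq" using T by (simp cong: measurable_cong_sets add: m)
      have spm: "space m = {0..1} \<times> {0..1}" using sets_eq_imp_space_eq[OF m] by (simp add: space_Sq)
      show "Gk ?k (distr m Sq T) = (\<lambda>p\<in>grid ?k. measure m (B (fst p) \<times> B (snd p)))"
        unfolding Gk_def
      proof (intro restrict_ext)
        fix p assume "p \<in> grid ?k"
        then have p: "fst p < ?k" "snd p < ?k" by (auto simp: grid_def)
        have "measure (distr m Sq T) (Ik ?k (fst p) \<times> Ik ?k (snd p)) = measure m (T -` (Ik ?k (fst p) \<times> Ik ?k (snd p)) \<inter> space m)"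
          by (rule measure_distr[OF Tm Ik_Times_sets[OF p]])
        also have "T -` (Ik ?k (fst p) \<times> Ik ?k (snd p)) \<inter> space m = B (fst p) \<times> B (snd p)"
          by (auto simp: T_def B_def spm)
        finally show "measure (distr m Sq T) (Ik ?k (fst p) \<times> Ik ?k (snd p)) = measure m (B (fst p) \<times> B (snd p))" .
      qed
    qed
    finally show ?thesis using law' by simp
  qed
  have conc: "AE m in R. measure m ({0..<1} \<times> {0..<1}) = 1"
    if R: "sets R = sets (prob_algebra Sq)" "distr R (MatSpace (fact 0)) (Gk (fact 0)) = \<mu> (fact 0)" for R
    using R(2) consistent_Delta[OF \<mu>, of 1] by (intro AE_concentrated R(1)) simp
  have "P = Q"
    by (rule law_determined_by_Gk[OF P Q _ conc[OF P(2) law] conc[OF Q(2) lawQ]]) (simp add: law lawQ)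
  then show "distr P (prob_algebra Sq) (\<lambda>m. distr m Sq (\<lambda>(x, y). (\<sigma> x, \<sigma> y))) = P"
    by (simp add: Q_def T_def)
qed

subsection \<open>Measures with prescribed cell masses\<close>

text \<open>The lower end of the cell of level \<open>n!\<close> containing \<open>x\<close>. It is
  defined on the whole line, so that one Borel map per target level connects that level with all
  finer ones.\<close>

definition grid_floor :: "nat \<Rightarrow> real \<Rightarrow> real" where
  "grid_floor n x = of_int \<lfloor>x * fact n\<rfloor> / fact n"

lemma measurable_grid_floor [measurable]: "grid_floor n \<in> borel_measurable borel"
  unfolding grid_floor_def[abs_def] by measurable

lemma floor_mult_fact_div:
  fixes x :: real
  assumes "(fact m :: nat) = q * fact n" "0 < q"
  shows "\<lfloor>x * fact n\<rfloor> = \<lfloor>x * fact m\<rfloor> div int q"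
proof -
  have "(fact m :: real) = real q * fact n" using assms(1) by (metis of_nat_fact of_nat_mult)
  then have "x * fact n = x * fact m / real q" using assms(2) by simp
  then show ?thesis using floor_divide_real_eq_div[of "int q" "x * fact m"] by simp
qed

lemma grid_floor_grid_floor:
  assumes "n \<le> m" shows "grid_floor n (grid_floor m x) = grid_floor n x"
proof -
  obtain q where q: "0 < q" "(fact m :: nat) = q * fact n" using fact_quotientE[OF assms] .
  show ?thesis
    unfolding grid_floor_def floor_mult_fact_div[OF q(2,1)] by simp
qed

lemma grid_floor_le: "grid_floor n x \<le> x"
  by (simp add: grid_floor_def field_simps)

lemma grid_floor_ratio:
  assumes "(fact m :: nat) = q * fact n" "0 < q"
  shows "grid_floor n (real v / fact m) = real (v div q) / fact n"
  unfolding grid_floor_def floor_mult_fact_div[OF assms] by (simp flip: zdiv_int)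

text \<open>The last subcell of level \<open>m!\<close> in a cell of level \<open>n!\<close> starts
  \<open>1 / m!\<close> before the upper end of that cell. Equality therefore marks the last
  subcell.\<close>

lemma grid_floor_gap:
  assumes "n \<le> m" "x = grid_floor m x"
  shows "x \<le> grid_floor n x + 1 / fact n - 1 / fact m"
proof -
  obtain q where q: "0 < q" "(fact m :: nat) = q * fact n" using fact_quotientE[OF assms(1)] .
  have fm: "(fact m :: real) = real q * fact n" using q(2) by (metis of_nat_fact of_nat_mult)
  define a where "a = \<lfloor>x * fact m\<rfloor>"
  have "a mod int q < int q" using q(1) by simp
  then have "a + 1 \<le> int q * (a div int q) + int q"
    using mult_div_mod_eq[of "int q" a] by linarith
  then have "real_of_int (a + 1) \<le> real_of_int (int q * (a div int q) + int q)" by linarith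
  then have "real_of_int a + 1 \<le> real q * (real_of_int (a div int q) + 1)" by (simp add: algebra_simps)
  then have "(real_of_int a + 1) / fact m \<le> real q * (real_of_int (a div int q) + 1) / fact m"
    by (simp add: divide_right_mono)
  also have "\<dots> = (real_of_int (a div int q) + 1) / fact n" using q(1) by (simp add: fm)
  also have "\<dots> = grid_floor n x + 1 / fact n"
    unfolding grid_floor_def floor_mult_fact_div[OF q(2,1)] by (simp add: a_def add_divide_distrib)
  finally show ?thesis using assms(2) by (simp add: grid_floor_def a_def add_divide_distrib)
qed

text \<open>The lower ends increase, and their limit stays in the closed cell of each level. It
  reaches the excluded upper end only if the sequence sits in the last subcell at every finer level,
  which is the second alternative.\<close>

lemma grid_floor_sequence_limit:
  assumes s: "\<And>n m. n \<le> m \<Longrightarrow> s n = grid_floor n (s m)" and "\<And>n. 0 \<le> s n" "\<And>n. s n < 1"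
  shows "0 \<le> lim s" "lim s \<le> 1" "s n \<le> lim s"
    "lim s < s n + 1 / fact n \<or> (\<forall>m\<ge>n. s m = s n + 1 / fact n - 1 / fact m)"
proof -
  have mono: "s n \<le> s m" if "n \<le> m" for n m using s[OF that] grid_floor_le by metis
  have gap: "s m \<le> s n + 1 / fact n - 1 / fact m" if "n \<le> m" for n m
    using grid_floor_gap[OF that, of "s m"] s[of m m] s[OF that] by simp
  have "incseq s" using mono by (simp add: incseq_def)
  then obtain l where "s \<longlonglongrightarrow> l"
    using incseq_convergent[of s 1] assms(3) less_imp_le by metis
  then have lim: "s \<longlonglongrightarrow> lim s" by (simp add: limI)
  show le: "s n \<le> lim s" for n
    by (rule LIMSEQ_le_const[OF lim]) (use mono in auto)
  show "0 \<le> lim s" using le[of 0] assms(2)[of 0] by linarith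
  show "lim s \<le> 1" by (rule LIMSEQ_le_const2[OF lim]) (use assms(3) in \<open>auto simp: less_imp_le\<close>)
  have up: "lim s \<le> s n + 1 / fact n" for n
  proof (rule LIMSEQ_le_const2[OF lim])
    have "s m \<le> s n + 1 / fact n" if "n \<le> m" for m
      using gap[OF that] by (smt (verit) divide_nonneg_nonneg fact_ge_zero)
    then show "\<exists>N. \<forall>m\<ge>N. s m \<le> s n + 1 / fact n" by blast
  qed
  show "lim s < s n + 1 / fact n \<or> (\<forall>m\<ge>n. s m = s n + 1 / fact n - 1 / fact m)"
  proof (cases "lim s < s n + 1 / fact n")
    case False
    \<comment> \<open>The limit is at most \<open>s m + 1 / m!\<close> and here at least
      \<open>s n + 1 / n!\<close>; with the bound from \<open>gap\<close> this forces
      equality.\<close>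
    then have "s m = s n + 1 / fact n - 1 / fact m" if "n \<le> m" for m
      using up[of m] gap[OF that] up[of n] by linarith
    then show ?thesis by blast
  qed simp
qed

text \<open>The event of lying in all \<open>A m\<close> with \<open>m \<ge> n\<close> is contained
  in each of them, so its measure is below every positive \<open>e\<close>.\<close>

lemma AE_ex_notin_if_small:
  fixes n :: nat
  assumes M: "finite_measure M" and A: "\<And>m. A m \<in> sets M"
    and small: "\<And>e. 0 < e \<Longrightarrow> \<exists>m\<ge>n. measure M (A m) < e"
  shows "AE x in M. \<exists>m\<ge>n. x \<notin> A m"
proof -
  interpret finite_measure M by fact
  let ?E = "\<Inter>m\<in>{n..}. A m"
  have E: "?E \<in> sets M" using A by (intro sets.countable_INT') (auto intro: countableI_type)
  have "measure M ?E \<le> e" if "0 < e" for e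
  proof -
    obtain m where m: "m \<ge> n" "measure M (A m) < e" using small[OF \<open>0 < e\<close>] by auto
    then have "measure M ?E \<le> measure M (A m)" using A by (intro finite_measure_mono) auto
    with m show ?thesis by simp
  qed
  then have "measure M ?E = 0" by (meson dense_ge measure_nonneg order_antisym)
  then have "?E \<in> null_sets M" using E by (auto simp: emeasure_eq_measure)
  then have "AE x in M. x \<notin> ?E" by (rule AE_not_in)
  then show ?thesis by (rule eventually_mono) auto
qed

text \<open>The measure is the law of the limit of a random nested sequence of lower left corners.
  In \<open>border\<close>, the divisibility condition selects the indices congruent to -1 modulo
  \<open>m!/n!\<close>, that is, the subcells in the last row or column of their block. Smallness of
  their mass prevents the limit from landing on the upper border and hence in a neighbouring
  cell.\<close>

lemma exists_measure_with_cell_masses: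
  fixes w :: "nat \<Rightarrow> nat \<times> nat \<Rightarrow> real"
  assumes nonneg: "\<And>n c. c \<in> grid (fact n) \<Longrightarrow> 0 \<le> w n c"
    and total: "\<And>n. (\<Sum>c\<in>grid (fact n). w n c) = 1"
    and cons: "\<And>n m q c. n \<le> m \<Longrightarrow> (fact m :: nat) = q * fact n \<Longrightarrow> c \<in> grid (fact n) \<Longrightarrow>
      w n c = (\<Sum>c'\<in>{c'\<in>grid (fact m). (fst c' div q, snd c' div q) = c}. w m c')"
    and border: "\<And>n pr e. pr \<in> {fst, snd} \<Longrightarrow> 0 < e \<Longrightarrow>
      \<exists>m\<ge>n. (\<Sum>c\<in>{c\<in>grid (fact m). fact m div fact n dvd Suc (pr c)}. w m c) < e"
  shows "\<exists>M\<in>space (prob_algebra Sq). \<forall>n. \<forall>c\<in>grid (fact n).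
    measure M (Ik (fact n) (fst c) \<times> Ik (fact n) (snd c)) = w n c"
proof -
  define pt :: "nat \<Rightarrow> nat \<times> nat \<Rightarrow> real \<times> real" where "pt n c = (real (fst c) / fact n, real (snd c) / fact n)" for n c
  define \<nu> where "\<nu> n = distr (point_measure (grid (fact n)) (\<lambda>c. ennreal (w n c))) borel (pt n)" for n
  define F where "F n = (\<lambda>z. (grid_floor n (fst z), grid_floor n (snd z)))" for n
  have F_meas: "F n \<in> borel_measurable borel" for n
    unfolding F_def borel_prod[symmetric] by measurable
  have sets_\<nu>: "sets (\<nu> n) = sets borel" for n by (simp add: \<nu>_def)
  have em: "emeasure (\<nu> n) A = ennreal (\<Sum>c\<in>{c\<in>grid (fact n). pt n c \<in> A}. w n c)" if "A \<in> sets borel" for n A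
  proof -
    have "emeasure (\<nu> n) A = emeasure (point_measure (grid (fact n)) (\<lambda>c. ennreal (w n c))) (pt n -` A \<inter> grid (fact n))"
      unfolding \<nu>_def using that by (subst emeasure_distr) (auto simp: space_point_measure)
    also have "\<dots> = (\<Sum>c\<in>pt n -` A \<inter> grid (fact n). ennreal (w n c))"
      by (rule emeasure_point_measure_finite) auto
    also have "pt n -` A \<inter> grid (fact n) = {c\<in>grid (fact n). pt n c \<in> A}" by auto
    also have "(\<Sum>c\<in>{c\<in>grid (fact n). pt n c \<in> A}. ennreal (w n c)) = ennreal (\<Sum>c\<in>{c\<in>grid (fact n). pt n c \<in> A}. w n c)"
      using nonneg by (intro sum_ennreal) auto
    finally show ?thesis .
  qed
  have prob_\<nu>: "prob_space (\<nu> n)" for n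
    using em[of UNIV n] total[of n] sets_eq_imp_space_eq[OF sets_\<nu>, of n] by (intro prob_spaceI) simp
  have me: "measure (\<nu> n) A = (\<Sum>c\<in>{c\<in>grid (fact n). pt n c \<in> A}. w n c)" if "A \<in> sets borel" for n A
    unfolding measure_def em[OF that] using nonneg by (intro enn2real_ennreal sum_nonneg) auto
  have F_pt: "F n (pt m c) = pt n (fst c div q, snd c div q)"
    if "(fact m :: nat) = q * fact n" "0 < q" for n m q c
    unfolding F_def pt_def using that by (simp add: grid_floor_ratio)
  have distr_F: "distr (\<nu> m) borel (F n) = \<nu> n" if nm: "n \<le> m" for n m
  proof (rule measure_eqI)
    obtain q where q: "0 < q" "(fact m :: nat) = q * fact n" using fact_quotientE[OF nm] .
    have F\<nu>: "F n \<in> measurable (\<nu> m) borel" using F_meas by (simp cong: measurable_cong_sets add: sets_\<nu>)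
    fix A assume "A \<in> sets (distr (\<nu> m) borel (F n))"
    then have A: "A \<in> sets borel" by simp
    define blk where "blk c = (fst c div q, snd c div q)" for c :: "nat \<times> nat"
    have blk: "blk c \<in> grid (fact n)" if "c \<in> grid (fact m)" for c
      using that q by (auto simp: blk_def grid_def less_mult_imp_div_less mult.commute)
    have "emeasure (distr (\<nu> m) borel (F n)) A = emeasure (\<nu> m) (F n -` A)"
      using A sets_eq_imp_space_eq[OF sets_\<nu>, of m] by (subst emeasure_distr[OF F\<nu>]) auto
    also have "\<dots> = ennreal (\<Sum>c\<in>{c\<in>grid (fact m). pt n (blk c) \<in> A}. w m c)"
      using measurable_sets[OF F_meas A, of n] by (subst em) (auto simp: F_pt[OF q(2,1)] blk_def)
    also have "(\<Sum>c\<in>{c\<in>grid (fact m). pt n (blk c) \<in> A}. w m c) =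
        (\<Sum>c\<in>{c\<in>grid (fact n). pt n c \<in> A}. \<Sum>c'\<in>{c'\<in>{c\<in>grid (fact m). pt n (blk c) \<in> A}. blk c' = c}. w m c')"
      using blk by (intro sum.group[symmetric]) auto
    also have "\<dots> = (\<Sum>c\<in>{c\<in>grid (fact n). pt n c \<in> A}. w n c)"
    proof (rule sum.cong[OF refl])
      fix c assume c: "c \<in> {c\<in>grid (fact n). pt n c \<in> A}"
      then have "w n c = (\<Sum>c'\<in>{c'\<in>grid (fact m). blk c' = c}. w m c')"
        using cons[OF nm q(2), of c] by (simp add: blk_def)
      also have "{c'\<in>grid (fact m). blk c' = c} = {c'\<in>{c\<in>grid (fact m). pt n (blk c) \<in> A}. blk c' = c}"
        using c by auto
      finally show "(\<Sum>c'\<in>{c'\<in>{c\<in>grid (fact m). pt n (blk c) \<in> A}. blk c' = c}. w m c') = w n c" ..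
    qed
    finally show "emeasure (distr (\<nu> m) borel (F n)) A = emeasure (\<nu> n) A" using em[OF A] by simp
  qed (simp add: sets_\<nu>)
  have "\<exists>L. prob_space L \<and> sets L = sets (PiM UNIV (\<lambda>_. borel)) \<and>
    (\<forall>n. distr L borel (\<lambda>x. x n) = \<nu> n) \<and> (AE x in L. \<forall>n m. n \<le> m \<longrightarrow> x n = F n (x m))"
    \<comment> \<open>The connecting map depends on the target level only, because rounding down
      forgets how fine its argument was.\<close>
    by (rule inverse_limit_exists[where f = "\<lambda>n m. F n", OF prob_\<nu> sets_\<nu> F_meas _ distr_F])
      (auto simp: F_def grid_floor_grid_floor)
  then obtain L where L: "prob_space L" and sets_L: "sets L = sets (PiM UNIV (\<lambda>_. borel))"
    and L_\<nu>: "\<And>n. distr L borel (\<lambda>x. x n) = \<nu> n" and L_F: "AE x in L. \<forall>n m. n \<le> m \<longrightarrow> x n = F n (x m)"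
    by blast
  interpret prob_space L by fact
  have comp: "(\<lambda>x. x n) \<in> measurable L borel" for n
    by (simp cong: measurable_cong_sets add: sets_L)
  have prob_L: "prob ((\<lambda>x. x n) -` A \<inter> space L) = (\<Sum>c\<in>{c\<in>grid (fact n). pt n c \<in> A}. w n c)"
    if "A \<in> sets borel" for n A
    using measure_distr[OF comp that, of n] me[OF that, of n] by (simp add: L_\<nu>)
  have AE_pt: "AE x in L. x n \<in> pt n ` grid (fact n)" for n
  proof -
    have fin: "pt n ` grid (fact n) \<in> sets borel" by (intro borel_closed finite_imp_closed) auto
    have "{c\<in>grid (fact n). pt n c \<in> pt n ` grid (fact n)} = grid (fact n)" by auto
    then have "prob ((\<lambda>x. x n) -` (pt n ` grid (fact n)) \<inter> space L) = 1"
      using prob_L[OF fin, of n] total[of n] by simp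
    then have "AE x in L. x \<in> (\<lambda>x. x n) -` (pt n ` grid (fact n)) \<inter> space L"
      using measurable_sets[OF comp fin] by (subst (asm) prob_eq_1) auto
    then show ?thesis by (rule eventually_mono) auto
  qed
  have AE_border: "AE x in L. \<exists>m\<ge>n. pr (x m) \<noteq> grid_floor n (pr (x m)) + 1 / fact n - 1 / fact m"
    if pr: "pr = fst \<and> prn = fst \<or> pr = snd \<and> prn = snd" for n and pr :: "real \<times> real \<Rightarrow> real" and prn :: "nat \<times> nat \<Rightarrow> nat"
  proof -
    define A where "A m = {z. pr z = grid_floor n (pr z) + 1 / fact n - 1 / fact m}" for m
    have [measurable]: "pr \<in> borel_measurable borel" using pr by (auto simp flip: borel_prod)
    have A: "A m \<in> sets borel" for m
    proof -
      have "{z\<in>space borel. pr z = grid_floor n (pr z) + 1 / fact n - 1 / fact m} \<in> sets borel" by measurable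
      then show ?thesis by (simp add: A_def)
    qed
    have "AE x in L. \<exists>m\<ge>n. x \<notin> (\<lambda>x. x m) -` A m \<inter> space L"
    proof (rule AE_ex_notin_if_small)
      show "(\<lambda>x. x m) -` A m \<inter> space L \<in> events" for m by (rule measurable_sets[OF comp A])
      fix e :: real assume "0 < e"
      then obtain m where m: "m \<ge> n" "(\<Sum>c\<in>{c\<in>grid (fact m). fact m div fact n dvd Suc (prn c)}. w m c) < e"
        using border[of prn e n] pr by auto
      obtain q where q: "0 < q" "(fact m :: nat) = q * fact n" using fact_quotientE[OF m(1)] .
      have fm: "(fact m :: real) = real q * fact n" using q(2) by (metis of_nat_fact of_nat_mult)
      have "fact m div fact n = q" using q by simp
      \<comment> \<open>Equality in the gap bound, written in integers, says that
        \<open>prn c + 1\<close> is the next multiple of \<open>q\<close>.\<close>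
      have "q dvd Suc (prn c)" if "pt m c \<in> A m" for c
      proof -
        have prpt: "pr (pt m c) = real (prn c) / fact m" using pr by (auto simp: pt_def)
        have "real (prn c) / fact m = real (prn c div q) / fact n + 1 / fact n - 1 / fact m"
          using that by (simp add: A_def prpt grid_floor_ratio[OF q(2,1)])
        also have "\<dots> = (real q * real (prn c div q) + real q - 1) / fact m"
          unfolding fm using q(1) by (simp add: field_simps)
        finally have "real (prn c) = real q * real (prn c div q) + real q - 1" by simp
        then have "real (Suc (prn c)) = real (q * Suc (prn c div q))" by (simp add: algebra_simps)
        then have "Suc (prn c) = q * Suc (prn c div q)" by (simp only: of_nat_eq_iff)
        then show ?thesis by simp
      qed
      then have "prob ((\<lambda>x. x m) -` A m \<inter> space L) \<le> (\<Sum>c\<in>{c\<in>grid (fact m). fact m div fact n dvd Suc (prn c)}. w m c)"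
        unfolding prob_L[OF A] \<open>fact m div fact n = q\<close> using nonneg by (intro sum_mono2) auto
      with m show "\<exists>m\<ge>n. prob ((\<lambda>x. x m) -` A m \<inter> space L) < e" by (intro exI[of _ m]) simp
    qed (rule finite_measure_axioms)
    then show ?thesis
      using AE_space by eventually_elim (auto simp: A_def)
  qed
  \<comment> \<open>Clamping makes \<open>Z\<close> map every sequence into the closed square; for
    almost every sequence the limits lie in \<open>[0,1]\<close> already.\<close>
  define Z where "Z x = (max 0 (min 1 (lim (\<lambda>n. fst (x n)))), max 0 (min 1 (lim (\<lambda>n. snd (x n)))))" for x :: "nat \<Rightarrow> real \<times> real"
  have Z: "Z \<in> measurable L Sq"
  proof -
    have lim_meas: "(\<lambda>x. lim (\<lambda>n. pr (x n))) \<in> borel_measurable L" if "pr \<in> {fst, snd}" for pr :: "real \<times> real \<Rightarrow> real"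
    proof (rule borel_measurable_lim_metric)
      have "pr \<in> borel_measurable borel" using that by (auto simp flip: borel_prod)
      then show "(\<lambda>x. pr (x n)) \<in> borel_measurable L" for n
        by (rule measurable_compose[OF comp])
    qed
    have "Z \<in> measurable L borel"
      unfolding Z_def[abs_def] borel_prod[symmetric]
      using lim_meas[of fst] lim_meas[of snd] by (intro measurable_Pair borel_measurable_max borel_measurable_min) auto
    then show ?thesis unfolding Sq_def by (intro measurable_restrict_space2) (auto simp: Z_def)
  qed
  define M where "M = distr L Sq Z"
  have M: "M \<in> space (prob_algebra Sq)"
    unfolding M_def using prob_space_distr[OF Z] by (simp add: space_prob_algebra)
  have AE_Z: "AE x in L. \<forall>n. \<forall>c\<in>grid (fact n). Z x \<in> Ik (fact n) (fst c) \<times> Ik (fact n) (snd c) \<longleftrightarrow> x n = pt n c"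
  proof -
    have "AE x in L. \<forall>n. x n \<in> pt n ` grid (fact n)" using AE_pt by (simp add: AE_all_countable)
    moreover have "AE x in L. \<forall>n. \<exists>m\<ge>n. fst (x m) \<noteq> grid_floor n (fst (x m)) + 1 / fact n - 1 / fact m"
      using AE_border[of fst fst] by (simp add: AE_all_countable)
    moreover have "AE x in L. \<forall>n. \<exists>m\<ge>n. snd (x m) \<noteq> grid_floor n (snd (x m)) + 1 / fact n - 1 / fact m"
      using AE_border[of snd snd] by (simp add: AE_all_countable)
    ultimately show ?thesis using L_F
    proof eventually_elim
      case (elim x)
      have coord: "max 0 (min 1 (lim s)) \<in> Ik (fact n) v \<longleftrightarrow> s n = real v / fact n"
        if s: "\<And>n m. n \<le> m \<Longrightarrow> s n = grid_floor n (s m)" and range: "\<And>n. \<exists>v<fact n. s n = real v / fact n"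
          and nb: "\<And>n. \<exists>m\<ge>n. s m \<noteq> grid_floor n (s m) + 1 / fact n - 1 / fact m" for s n v
      proof -
        have s01: "0 \<le> s n" "s n < 1" for n
        proof -
          obtain v where v: "v < fact n" "s n = real v / fact n" using range by blast
          have "real v < fact n" using v(1) by (metis of_nat_fact of_nat_less_iff)
          then show "0 \<le> s n" "s n < 1" using v(2) by auto
        qed
        note lims = grid_floor_sequence_limit[of s, OF s s01]
        \<comment> \<open>The level \<open>m\<close> refutes the alternative in which the limit
          touches the upper end, so the limit lies in the half-open cell.\<close>
        obtain m where m: "m \<ge> n" "s m \<noteq> grid_floor n (s m) + 1 / fact n - 1 / fact m" using nb by blast
        then have "s m \<noteq> s n + 1 / fact n - 1 / fact m" using s[OF m(1)] by simp
        then have less: "lim s < s n + 1 / fact n" using lims(4)[of n] m(1) by blast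
        obtain u where u: "s n = real u / fact n" using range by blast
        have "\<lfloor>lim s * real (fact n)\<rfloor> = int u"
          using lims(3)[of n] less unfolding u by (auto simp: floor_eq_iff field_simps)
        then have "lim s \<in> Ik (fact n) v \<longleftrightarrow> u = v" by (simp add: Ik_iff_floor)
        moreover have "max 0 (min 1 (lim s)) = lim s" using lims(1,2) by simp
        ultimately show ?thesis by (simp add: u)
      qed
      have F: "x n = F n (x m)" if "n \<le> m" for n m using elim that by blast
      have sc: "\<exists>v<fact n. fst (x n) = real v / fact n" "\<exists>v<fact n. snd (x n) = real v / fact n" for n
      proof -
        obtain c where "c \<in> grid (fact n)" "x n = pt n c" using elim(1) by blast
        then show "\<exists>v<fact n. fst (x n) = real v / fact n" "\<exists>v<fact n. snd (x n) = real v / fact n"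
          by (auto simp: pt_def grid_def)
      qed
      have "fst (x n) = grid_floor n (fst (x m))" "snd (x n) = grid_floor n (snd (x m))" if "n \<le> m" for n m
        using F[OF that] by (simp_all add: F_def)
      then have c1: "max 0 (min 1 (lim (\<lambda>n. fst (x n)))) \<in> Ik (fact n) v \<longleftrightarrow> fst (x n) = real v / fact n"
        and c2: "max 0 (min 1 (lim (\<lambda>n. snd (x n)))) \<in> Ik (fact n) v \<longleftrightarrow> snd (x n) = real v / fact n" for n v
        using sc elim(2,3) by (intro coord[of "\<lambda>n. fst (x n)"] coord[of "\<lambda>n. snd (x n)"]; blast)+
      show ?case
        unfolding Z_def mem_Times_iff by (simp add: c1 c2 pt_def prod_eq_iff)
    qed
  qed
  have "measure M (Ik (fact n) (fst c) \<times> Ik (fact n) (snd c)) = w n c" if c: "c \<in> grid (fact n)" for n c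
  proof -
    have cell: "Ik (fact n) (fst c) \<times> Ik (fact n) (snd c) \<in> sets Sq"
      using c by (intro Ik_Times_sets) (auto simp: grid_def)
    have "measure M (Ik (fact n) (fst c) \<times> Ik (fact n) (snd c)) = prob (Z -` (Ik (fact n) (fst c) \<times> Ik (fact n) (snd c)) \<inter> space L)"
      unfolding M_def by (rule measure_distr[OF Z cell])
    also have "\<dots> = prob ((\<lambda>x. x n) -` {pt n c} \<inter> space L)"
    proof (rule finite_measure_eq_AE)
      show "AE x in L. (x \<in> Z -` (Ik (fact n) (fst c) \<times> Ik (fact n) (snd c)) \<inter> space L) = (x \<in> (\<lambda>x. x n) -` {pt n c} \<inter> space L)"
        using AE_Z by eventually_elim (use c in auto)
    qed (use measurable_sets[OF Z cell] measurable_sets[OF comp, of "{pt n c}" n] in auto)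
    also have "\<dots> = (\<Sum>c'\<in>{c'\<in>grid (fact n). pt n c' \<in> {pt n c}}. w n c')" by (rule prob_L) simp
    also have "{c'\<in>grid (fact n). pt n c' \<in> {pt n c}} = {c}" using c by (auto simp: pt_def prod_eq_iff)
    finally show ?thesis by simp
  qed
  with M show ?thesis by blast
qed

subsection \<open>Existence\<close>

lemma equipartition_div:
  assumes "0 < q" shows "equipartition q k (\<lambda>v. v div q)"
proof -
  have "{v\<in>{..<q*k}. v div q = i} = {i*q..<i*q+q}" if "i < k" for i
  proof -
    have "(i + 1) * q \<le> k * q" using that by (intro mult_right_mono) auto
    then have le: "i * q + q \<le> q * k" by (simp add: algebra_simps)
    have iff: "v div q = i \<longleftrightarrow> i * q \<le> v \<and> v < i * q + q" for v
    proof -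
      have "v div q = i \<longleftrightarrow> i \<le> v div q \<and> v div q < i + 1" by linarith
      then show ?thesis
        using assms by (simp add: less_eq_div_iff_mult_less_eq div_less_iff_less_mult algebra_simps)
    qed
    show ?thesis
      unfolding iff using le by (simp only: set_eq_iff mem_Collect_eq lessThan_iff atLeastLessThan_iff) linarith
  qed
  then have "card {v\<in>{..<q*k}. v div q = i} = q" if "i < k" for i using that by simp
  moreover have "v div q < k" if "v < q * k" for v
    using that by (intro less_mult_imp_div_less) (simp add: mult.commute)
  ultimately show ?thesis unfolding equipartition_def by (simp add: Pi_iff)
qed

section \<open>Coarsening on a common Polish space and the mass near cell borders\<close>

definition block_index :: "nat \<Rightarrow> nat \<times> nat \<Rightarrow> nat \<times> nat" where
  "block_index q c = (fst c div q, snd c div q)"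

text \<open>The block version of \<open>rho\<close>, with 0 instead of \<open>undefined\<close> off
  the grid and without restricted functions. Matrices of all sizes thereby live in the one Polish
  space of functions on \<open>nat \<times> nat\<close>, as \<open>inverse_limit_exists\<close>
  requires.\<close>

definition coarsen :: "nat \<Rightarrow> nat \<Rightarrow> (nat \<times> nat \<Rightarrow> real) \<Rightarrow> nat \<times> nat \<Rightarrow> real" where
  "coarsen m k X = (\<lambda>c. if c \<in> grid k then \<Sum>c'\<in>{c'\<in>grid m. block_index (m div k) c' = c}. X c' else 0)"

lemma block_index_grid: "0 < q \<Longrightarrow> c \<in> grid (q * k) \<Longrightarrow> block_index q c \<in> grid k"
  by (auto simp: block_index_def grid_def less_mult_imp_div_less mult.commute)

lemma coarsen_coarsen:
  assumes "0 < q" "0 < r" "0 < k"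
  shows "coarsen (q*k) k (coarsen (r*(q*k)) (q*k) X) = coarsen (r*(q*k)) k X"
proof
  fix c
  show "coarsen (q*k) k (coarsen (r*(q*k)) (q*k) X) c = coarsen (r*(q*k)) k X c"
  proof (cases "c \<in> grid k")
    case True
    have bb: "block_index q (block_index r c'') = block_index (r*q) c''" for c''
      by (simp add: block_index_def div_mult2_eq)
    let ?S = "{c''\<in>grid (r*(q*k)). block_index (r*q) c'' = c}"
    have "coarsen (q*k) k (coarsen (r*(q*k)) (q*k) X) c =
        (\<Sum>c'\<in>{c'\<in>grid (q*k). block_index q c' = c}. \<Sum>c''\<in>{c''\<in>grid (r*(q*k)). block_index r c'' = c'}. X c'')"
      using True assms by (simp add: coarsen_def)
    also have "\<dots> = (\<Sum>c'\<in>{c'\<in>grid (q*k). block_index q c' = c}. \<Sum>c''\<in>{c''\<in>?S. block_index r c'' = c'}. X c'')"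
    proof (intro sum.cong refl)
      fix c' assume "c' \<in> {c'\<in>grid (q*k). block_index q c' = c}"
      then show "{c''\<in>grid (r*(q*k)). block_index r c'' = c'} = {c''\<in>?S. block_index r c'' = c'}"
        by (auto simp flip: bb)
    qed
    also have "\<dots> = (\<Sum>c''\<in>?S. X c'')"
      using block_index_grid[OF assms(2), of _ "q*k"] by (intro sum.group) (auto simp flip: bb)
    also have "\<dots> = coarsen (r*(q*k)) k X c"
      using True assms by (simp add: coarsen_def flip: mult.assoc)
    finally show ?thesis .
  qed (simp add: coarsen_def)
qed

lemma coarsen_eq_rho:
  assumes "0 < q" "0 < k" "c \<in> grid k"
  shows "coarsen (q*k) k X c = rho (q*k) k (\<lambda>v. v div q) X c"
proof -
  have "{c'\<in>grid (q*k). block_index q c' = c} =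
      {v\<in>{..<q*k}. v div q = fst c} \<times> {u\<in>{..<q*k}. u div q = snd c}"
    by (auto simp: grid_def block_index_def)
  then have "coarsen (q*k) k X c =
      (\<Sum>c'\<in>{v\<in>{..<q*k}. v div q = fst c} \<times> {u\<in>{..<q*k}. u div q = snd c}. X c')"
    using assms by (simp add: coarsen_def)
  also have "\<dots> = rho (q*k) k (\<lambda>v. v div q) X c"
    using assms by (simp add: rho_def sum.cartesian_product case_prod_beta')
  finally show ?thesis .
qed

lemma measurable_coarsen: "coarsen m k \<in> borel_measurable borel"
proof (rule measurable_coordinatewise_then_product)
  fix c show "(\<lambda>X. coarsen m k X c) \<in> borel_measurable borel"
    by (cases "c \<in> grid k") (auto simp: coarsen_def intro!: borel_measurable_sum)
qed

text \<open>The indices that are last in their block are \<open>q * j - 1\<close> for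
  \<open>j = 1, ..., k\<close>. There are at most \<open>k\<close> of them, each with mean mass
  \<open>1 / (q * k)\<close>. The unreduced quotient becomes \<open>n! / m!\<close> in the
  application.\<close>

lemma expected_border_mass:
  assumes \<mu>: "equipartition_consistent \<mu>" and q: "0 < q" and k: "0 < k" and pr: "pr \<in> {fst, snd}"
  shows "(\<integral>\<^sup>+X. ennreal (\<Sum>c\<in>{c\<in>grid (q*k). q dvd Suc (pr c)}. X c) \<partial>\<mu> (q*k)) \<le> ennreal (real k / real (q*k))"
proof -
  have qk: "1 \<le> q*k" using q k by (simp add: Suc_le_eq)
  have s: "sets (\<mu> (q*k)) = sets (MatSpace (q*k))"
    using consistent_Delta[OF \<mu> qk] by (auto simp: prob_on_Delta_def)
  define V where "V = {v\<in>{..<q*k}. q dvd Suc v}"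
  have "V \<subseteq> (\<lambda>j. q*j - 1) ` {1..k}"
  proof
    fix v assume v: "v \<in> V"
    then obtain j where j: "Suc v = q * j" by (auto simp: V_def dvd_def)
    have "0 < j" using j by (cases j) auto
    moreover have "q * j \<le> q * k" using v by (simp add: V_def Suc_le_eq flip: j)
    then have "j \<le> k" using q by simp
    ultimately show "v \<in> (\<lambda>j. q*j - 1) ` {1..k}" using j by (intro image_eqI[of _ _ j]) auto
  qed
  then have "card V \<le> card ((\<lambda>j. q*j - 1) ` {1..k})" by (intro card_mono) auto
  also have "\<dots> \<le> k" using card_image_le[of "{1..k}" "\<lambda>j. q*j - 1"] by simp
  finally have cV: "card V \<le> k" .
  have fV: "finite V" by (simp add: V_def)
  let ?g = "\<lambda>v X. \<Sum>c\<in>{c\<in>grid (q*k). pr c = v}. X c"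
  have "(\<integral>\<^sup>+X. ennreal (\<Sum>c\<in>{c\<in>grid (q*k). q dvd Suc (pr c)}. X c) \<partial>\<mu> (q*k))
      = (\<integral>\<^sup>+X. (\<Sum>v\<in>V. ennreal (?g v X)) \<partial>\<mu> (q*k))"
  proof (rule nn_integral_cong_AE)
    show "AE X in \<mu> (q*k). ennreal (\<Sum>c\<in>{c\<in>grid (q*k). q dvd Suc (pr c)}. X c) = (\<Sum>v\<in>V. ennreal (?g v X))"
      using AE_Delta[OF consistent_Delta[OF \<mu> qk]]
    proof eventually_elim
      case (elim X)
      let ?S = "{c\<in>grid (q*k). q dvd Suc (pr c)}"
      have "(\<Sum>c\<in>?S. X c) = (\<Sum>v\<in>V. \<Sum>c\<in>{c\<in>?S. pr c = v}. X c)"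
        using fV pr by (intro sum.group[symmetric]) (auto simp: V_def grid_def)
      also have "\<dots> = (\<Sum>v\<in>V. ?g v X)"
        by (intro sum.cong refl) (auto simp: V_def)
      moreover have "(\<Sum>v\<in>V. ennreal (?g v X)) = ennreal (\<Sum>v\<in>V. ?g v X)"
        using elim by (intro sum_ennreal sum_nonneg) (auto simp: Delta_def)
      ultimately show ?case by simp
    qed
  qed
  also have "\<dots> = (\<Sum>v\<in>V. \<integral>\<^sup>+X. ennreal (?g v X) \<partial>\<mu> (q*k))"
  proof (rule nn_integral_sum)
    fix v
    have "?g v \<in> borel_measurable (MatSpace (q*k))"
      by (intro borel_measurable_sum measurable_entry) auto
    then have "?g v \<in> borel_measurable (\<mu> (q*k))" by (simp cong: measurable_cong_sets add: s)
    then show "(\<lambda>X. ennreal (?g v X)) \<in> borel_measurable (\<mu> (q*k))"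
      by (rule measurable_compose[OF _ measurable_ennreal])
  qed
  also have "\<dots> = (\<Sum>v\<in>V. ennreal (1 / real (q*k)))"
    by (intro sum.cong refl expected_matrix_margin[OF \<mu> _ pr]) (auto simp: V_def)
  also have "\<dots> = ennreal (real (card V) / real (q*k))"
    by (subst sum_ennreal) (simp_all del: of_nat_mult)
  also have "\<dots> \<le> ennreal (real k / real (q*k))"
    using cV by (intro ennreal_leI divide_right_mono) auto
  finally show ?thesis .
qed

text \<open>Padding with zeros (\<open>ext\<close>) carries the laws to the common space. There
  coarsening after padding equals padding after \<open>rho\<close>, so consistency of the model is
  consistency of the inverse system.\<close>

lemma exists_random_refinement:
  assumes \<mu>: "equipartition_consistent \<mu>"
  shows "\<exists>L. prob_space L \<and> sets L = sets (PiM UNIV (\<lambda>_. borel)) \<and>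
    (\<forall>n. distr L (MatSpace (fact n)) (\<lambda>\<omega>. restrict (\<omega> n) (grid (fact n))) = \<mu> (fact n)) \<and>
    (AE \<omega> in L. \<forall>n m. n \<le> m \<longrightarrow> \<omega> n = coarsen (fact m) (fact n) (\<omega> m))"
proof -
  define ext where "ext n X = (\<lambda>c. if c \<in> grid (fact n) then X c else 0)" for n and X :: "nat \<times> nat \<Rightarrow> real"
  define \<nu> where "\<nu> n = distr (\<mu> (fact n)) borel (ext n)" for n
  have \<mu>n: "prob_space (\<mu> (fact n))" "sets (\<mu> (fact n)) = sets (MatSpace (fact n))" for n
    using consistent_Delta[OF \<mu>, of "fact n"] by (auto simp: prob_on_Delta_def)
  have ext_meas: "ext n \<in> measurable (MatSpace (fact n)) borel" for n
  proof (rule measurable_coordinatewise_then_product)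
    fix c show "(\<lambda>X. ext n X c) \<in> borel_measurable (MatSpace (fact n))"
      by (cases "c \<in> grid (fact n)") (auto simp: ext_def intro: measurable_entry)
  qed
  have ext_\<mu>: "ext n \<in> measurable (\<mu> (fact n)) borel" for n
    using ext_meas by (simp cong: measurable_cong_sets add: \<mu>n)
  have prob_\<nu>: "prob_space (\<nu> n)" for n
    unfolding \<nu>_def by (rule prob_space.prob_space_distr[OF \<mu>n(1) ext_\<mu>])
  have sets_\<nu>: "sets (\<nu> n) = sets borel" for n by (simp add: \<nu>_def)
  have coarsen_comp: "coarsen (fact m) (fact n) (coarsen (fact k) (fact m) X) = coarsen (fact k) (fact n) X"
    if nm: "n \<le> m" and mk: "m \<le> k" for n m k X
  proof -
    obtain q where q: "0 < q" "(fact m :: nat) = q * fact n" using fact_quotientE[OF nm] .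
    obtain r where r: "0 < r" "(fact k :: nat) = r * fact m" using fact_quotientE[OF mk] .
    show ?thesis unfolding r(2) q(2) using q(1) r(1) by (intro coarsen_coarsen) auto
  qed
  have distr_coarsen: "distr (\<nu> m) borel (coarsen (fact m) (fact n)) = \<nu> n" if nm: "n \<le> m" for n m
  proof -
    obtain q where q: "0 < q" "(fact m :: nat) = q * fact n" using fact_quotientE[OF nm] .
    let ?r = "rho (fact m) (fact n) (\<lambda>v. v div q)"
    have r\<mu>: "?r \<in> measurable (\<mu> (fact m)) (MatSpace (fact n))"
      using measurable_rho by (simp cong: measurable_cong_sets add: \<mu>n)
    have eq: "coarsen (fact m) (fact n) (ext m X) = ext n (?r X)" for X
    proof
      fix c
      have "coarsen (fact m) (fact n) (ext m X) c = coarsen (fact m) (fact n) X c"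
        unfolding coarsen_def ext_def by (auto intro!: sum.cong)
      also have "\<dots> = ext n (?r X) c"
        using coarsen_eq_rho[OF q(1), of "fact n" c X] q(2) by (auto simp: ext_def coarsen_def)
      finally show "coarsen (fact m) (fact n) (ext m X) c = ext n (?r X) c" .
    qed
    have "distr (\<nu> m) borel (coarsen (fact m) (fact n)) = distr (\<mu> (fact m)) borel (ext n \<circ> ?r)"
      unfolding \<nu>_def by (subst distr_distr[OF measurable_coarsen ext_\<mu>]) (simp add: comp_def eq)
    also have "\<dots> = distr (distr (\<mu> (fact m)) (MatSpace (fact n)) ?r) borel (ext n)"
      by (rule distr_distr[OF ext_meas r\<mu>, symmetric])
    also have "distr (\<mu> (fact m)) (MatSpace (fact n)) ?r = \<mu> (fact n)"
      unfolding q(2) using q(1) by (intro consistent_rho[OF \<mu>] equipartition_div) auto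
    finally show ?thesis by (simp add: \<nu>_def)
  qed
  have "\<exists>L. prob_space L \<and> sets L = sets (PiM UNIV (\<lambda>_. borel)) \<and>
    (\<forall>n. distr L borel (\<lambda>x. x n) = \<nu> n) \<and> (AE x in L. \<forall>n m. n \<le> m \<longrightarrow> x n = coarsen (fact m) (fact n) (x m))"
    by (rule inverse_limit_exists[where f = "\<lambda>n m. coarsen (fact m) (fact n)", OF prob_\<nu> sets_\<nu> measurable_coarsen coarsen_comp distr_coarsen])
  then obtain L where L: "prob_space L" "sets L = sets (PiM UNIV (\<lambda>_. borel))"
    and L_\<nu>: "\<And>n. distr L borel (\<lambda>x. x n) = \<nu> n"
    and L_c: "AE x in L. \<forall>n m. n \<le> m \<longrightarrow> x n = coarsen (fact m) (fact n) (x m)" by blast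
  have comp: "(\<lambda>x. x n) \<in> measurable L borel" for n
    by (simp cong: measurable_cong_sets add: L)
  have "distr L (MatSpace (fact n)) (\<lambda>\<omega>. restrict (\<omega> n) (grid (fact n))) = \<mu> (fact n)" for n
  proof -
    let ?R = "\<lambda>X. restrict X (grid (fact n))"
    have R: "?R \<in> measurable borel (MatSpace (fact n))"
      unfolding MatSpace_def by (intro measurable_restrict) auto
    have "distr L (MatSpace (fact n)) (\<lambda>\<omega>. restrict (\<omega> n) (grid (fact n))) = distr (\<nu> n) (MatSpace (fact n)) ?R"
      unfolding L_\<nu>[symmetric] by (subst distr_distr[OF R comp]) (simp add: comp_def)
    also have "\<dots> = distr (\<mu> (fact n)) (MatSpace (fact n)) (?R \<circ> ext n)"
      unfolding \<nu>_def by (rule distr_distr[OF R ext_\<mu>])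
    \<comment> \<open>Restricting undoes the padding on extensional functions, and these are all the
      points of the space of \<open>\<mu> (fact n)\<close>.\<close>
    also have "\<dots> = distr (\<mu> (fact n)) (\<mu> (fact n)) (\<lambda>X. X)"
    proof (rule distr_cong)
      fix X assume "X \<in> space (\<mu> (fact n))"
      then have "X \<in> extensional (grid (fact n))"
        using sets_eq_imp_space_eq[OF \<mu>n(2), of n] by (simp add: MatSpace_def space_PiM PiE_def)
      then show "(?R \<circ> ext n) X = X" by (auto simp: ext_def extensional_def fun_eq_iff)
    qed (simp_all add: \<mu>n)
    also have "\<dots> = \<mu> (fact n)" by (rule distr_id)
    finally show ?thesis .
  qed
  with L L_c show ?thesis by blast
qed

section \<open>From random consistent matrices to a random measure\<close>

text \<open>For almost every refinement the hypotheses of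
  \<open>exists_measure_with_cell_masses\<close> hold, and a measure is chosen for each. The choice
  is measurable because its cell masses are the entries of the refinement.\<close>

lemma exists_law_with_Gk_laws:
  assumes \<mu>: "equipartition_consistent \<mu>"
  shows "\<exists>P. prob_space P \<and> sets P = sets (prob_algebra Sq) \<and>
    (\<forall>n. distr P (MatSpace (fact n)) (Gk (fact n)) = \<mu> (fact n))"
proof -
  obtain L where L: "prob_space L" "sets L = sets (PiM UNIV (\<lambda>_. borel))"
    and law: "\<And>n. distr L (MatSpace (fact n)) (\<lambda>\<omega>. restrict (\<omega> n) (grid (fact n))) = \<mu> (fact n)"
    and L_c: "AE \<omega> in L. \<forall>n m. n \<le> m \<longrightarrow> \<omega> n = coarsen (fact m) (fact n) (\<omega> m)"
    using exists_random_refinement[OF \<mu>] by blast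
  interpret prob_space L by fact
  let ?R = "\<lambda>n \<omega>. restrict (\<omega> n) (grid (fact n))"
  have R: "?R n \<in> measurable L (MatSpace (fact n))" for n
  proof -
    have "(\<lambda>\<omega>. \<omega> n) \<in> measurable L borel" by (simp cong: measurable_cong_sets add: L)
    moreover have "(\<lambda>X. restrict X (grid (fact n))) \<in> measurable borel (MatSpace (fact n))"
      unfolding MatSpace_def by (intro measurable_restrict) auto
    ultimately show ?thesis by (rule measurable_compose)
  qed
  have entry: "(\<lambda>\<omega>. \<omega> n c) \<in> borel_measurable L" if "c \<in> grid (fact n)" for n c
    using measurable_compose[OF R measurable_entry[OF that]] that by simp
  have AE_Delta_n: "AE \<omega> in L. ?R n \<omega> \<in> Delta (fact n)" for n
  proof -
    have "AE X in distr L (MatSpace (fact n)) (?R n). X \<in> Delta (fact n)"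
      unfolding law using consistent_Delta[OF \<mu>, of "fact n"] by (intro AE_Delta) simp
    then show ?thesis
      using Delta_sets[of "fact n"] by (subst (asm) AE_distr_iff[OF R]) (auto dest: sets.sets_into_space simp: Int_absorb2)
  qed
  define b where "b pr n m \<omega> = (\<Sum>c\<in>{c\<in>grid (fact m). fact m div fact n dvd Suc (pr c)}. \<omega> m c)"
    for pr :: "nat \<times> nat \<Rightarrow> nat" and n m and \<omega> :: "nat \<Rightarrow> nat \<times> nat \<Rightarrow> real"
  have b_meas: "b pr n m \<in> borel_measurable L" for pr n m
    unfolding b_def[abs_def] by (intro borel_measurable_sum entry) auto
  have Eb: "(\<integral>\<^sup>+\<omega>. ennreal (b pr n m \<omega>) \<partial>L) \<le> ennreal (fact n / fact m)"
    if pr: "pr \<in> {fst, snd}" and nm: "n \<le> m" for pr n m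
  proof -
    obtain q where q: "0 < q" "(fact m :: nat) = q * fact n" using fact_quotientE[OF nm] .
    let ?S = "{c\<in>grid (fact m). q dvd Suc (pr c)}"
    have "b pr n m \<omega> = (\<Sum>c\<in>?S. ?R m \<omega> c)" for \<omega>
      unfolding b_def using q by (intro sum.cong) auto
    then have "(\<integral>\<^sup>+\<omega>. ennreal (b pr n m \<omega>) \<partial>L) = (\<integral>\<^sup>+\<omega>. ennreal (\<Sum>c\<in>?S. ?R m \<omega> c) \<partial>L)" by simp
    also have "\<dots> = (\<integral>\<^sup>+X. ennreal (\<Sum>c\<in>?S. X c) \<partial>distr L (MatSpace (fact m)) (?R m))"
      by (rule nn_integral_distr[OF R, symmetric])
        (auto intro!: measurable_compose[OF _ measurable_ennreal] borel_measurable_sum measurable_entry)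
    also have "\<dots> \<le> ennreal (real (fact n) / real (fact m))"
      unfolding law unfolding q(2) using q(1) by (intro expected_border_mass[OF \<mu> _ _ pr]) auto
    finally show ?thesis by simp
  qed
  \<comment> \<open>By Markov's inequality the border mass reaches \<open>e\<close> with probability
    at most \<open>n! / (e * m!)\<close>, which is small for large \<open>m\<close>.\<close>
  have AE_b: "AE \<omega> in L. \<exists>m\<ge>n. b pr n m \<omega> < e" if pr: "pr \<in> {fst, snd}" and e: "0 < e" for pr n e
  proof -
    have "AE \<omega> in L. \<exists>m\<ge>n. \<omega> \<notin> {\<omega>\<in>space L. e \<le> b pr n m \<omega>}"
    proof (rule AE_ex_notin_if_small)
      show "{\<omega>\<in>space L. e \<le> b pr n m \<omega>} \<in> events" for m using b_meas by measurable
      fix \<delta> :: real assume "0 < \<delta>"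
      have le: "prob {\<omega>\<in>space L. e \<le> b pr n m \<omega>} \<le> fact n / e * (1 / fact m)" if nm: "n \<le> m" for m
      proof -
        have "emeasure L {\<omega>\<in>space L. e \<le> b pr n m \<omega>} \<le> emeasure L {\<omega>\<in>space L. 1 \<le> ennreal (1 / e) * ennreal (b pr n m \<omega>)}"
        proof (rule emeasure_mono)
          show "{\<omega>\<in>space L. e \<le> b pr n m \<omega>} \<subseteq> {\<omega>\<in>space L. 1 \<le> ennreal (1 / e) * ennreal (b pr n m \<omega>)}"
          proof safe
            fix \<omega> assume "e \<le> b pr n m \<omega>"
            then have "1 \<le> 1 / e * b pr n m \<omega>" using e by (simp add: field_simps)
            then show "1 \<le> ennreal (1 / e) * ennreal (b pr n m \<omega>)"
              using e by (subst ennreal_mult'[symmetric]) (auto simp flip: ennreal_1 intro!: ennreal_leI)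
          qed
        qed (use b_meas in measurable)
        also have "\<dots> \<le> ennreal (1 / e) * (\<integral>\<^sup>+\<omega>. ennreal (b pr n m \<omega>) * indicator (space L) \<omega> \<partial>L)"
          using b_meas by (intro nn_integral_Markov_inequality) auto
        also have "(\<integral>\<^sup>+\<omega>. ennreal (b pr n m \<omega>) * indicator (space L) \<omega> \<partial>L) = (\<integral>\<^sup>+\<omega>. ennreal (b pr n m \<omega>) \<partial>L)"
          by (intro nn_integral_cong) auto
        also have "ennreal (1 / e) * \<dots> \<le> ennreal (1 / e) * ennreal (fact n / fact m)"
          using Eb[OF pr nm] by (rule mult_left_mono) simp
        also have "\<dots> = ennreal (fact n / e * (1 / fact m))"
          using e by (subst ennreal_mult'[symmetric]) auto
        finally show ?thesis using e by (simp add: emeasure_eq_measure)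
      qed
      have "(\<lambda>m. fact n / e * (1 / (fact m :: real))) \<longlonglongrightarrow> fact n / e * 0"
        by (intro tendsto_intros inverse_fact_tendsto_0)
      then have "eventually (\<lambda>m. fact n / e * (1 / (fact m :: real)) < \<delta>) sequentially"
        using \<open>0 < \<delta>\<close> by (intro order_tendstoD(2)) auto
      then have "eventually (\<lambda>m. fact n / e * (1 / (fact m :: real)) < \<delta> \<and> n \<le> m) sequentially"
        by (intro eventually_conj eventually_ge_at_top)
      then obtain m where "fact n / e * (1 / (fact m :: real)) < \<delta>" "n \<le> m" by (auto dest: eventually_happens)
      with le[of m] show "\<exists>m\<ge>n. prob {\<omega>\<in>space L. e \<le> b pr n m \<omega>} < \<delta>" by (intro exI[of _ m]) linarith
    qed (rule finite_measure_axioms)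
    then show ?thesis using AE_space by eventually_elim (auto simp: not_le)
  qed
  let ?cells = "\<lambda>\<omega> M. M \<in> space (prob_algebra Sq) \<and> (\<forall>n. \<forall>c\<in>grid (fact n).
    measure M (Ik (fact n) (fst c) \<times> Ik (fact n) (snd c)) = \<omega> n c)"
  have AE_ex: "AE \<omega> in L. (\<exists>M. ?cells \<omega> M) \<and> (\<forall>n. ?R n \<omega> \<in> Delta (fact n))"
  proof -
    have "AE \<omega> in L. \<forall>n. ?R n \<omega> \<in> Delta (fact n)" using AE_Delta_n by (simp add: AE_all_countable)
    \<comment> \<open>The thresholds \<open>1 / (j + 1)\<close> replace an arbitrary positive one,
      so that only countably many null sets are joined.\<close>
    moreover have "AE \<omega> in L. \<forall>n j. \<exists>m\<ge>n. b fst n m \<omega> < 1 / real (Suc j)"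
      using AE_b[of fst] by (simp add: AE_all_countable)
    moreover have "AE \<omega> in L. \<forall>n j. \<exists>m\<ge>n. b snd n m \<omega> < 1 / real (Suc j)"
      using AE_b[of snd] by (simp add: AE_all_countable)
    ultimately show ?thesis using L_c
    proof eventually_elim
      case (elim \<omega>)
      have "\<exists>M\<in>space (prob_algebra Sq). \<forall>n. \<forall>c\<in>grid (fact n).
          measure M (Ik (fact n) (fst c) \<times> Ik (fact n) (snd c)) = \<omega> n c"
      proof (rule exists_measure_with_cell_masses)
        show "0 \<le> \<omega> n c" if "c \<in> grid (fact n)" for n c
          using elim(1) that by (auto simp: Delta_def dest!: spec[of _ n])
        show "(\<Sum>c\<in>grid (fact n). \<omega> n c) = 1" for n
          using elim(1) by (auto simp: Delta_def dest!: spec[of _ n])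
        show "\<omega> n c = (\<Sum>c'\<in>{c'\<in>grid (fact m). (fst c' div q, snd c' div q) = c}. \<omega> m c')"
          if "n \<le> m" "(fact m :: nat) = q * fact n" "c \<in> grid (fact n)" for n m q c
        proof -
          have "\<omega> n c = coarsen (fact m) (fact n) (\<omega> m) c" using elim(4) that(1) by metis
          also have "fact m div fact n = q" using that(2) by simp
          then have "coarsen (fact m) (fact n) (\<omega> m) c = (\<Sum>c'\<in>{c'\<in>grid (fact m). (fst c' div q, snd c' div q) = c}. \<omega> m c')"
            using that(3) by (simp add: coarsen_def block_index_def)
          finally show ?thesis .
        qed
        show "\<exists>m\<ge>n. (\<Sum>c\<in>{c\<in>grid (fact m). fact m div fact n dvd Suc (pr c)}. \<omega> m c) < e"
          if pr: "pr \<in> {fst, snd}" and e: "0 < e" for n pr e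
        proof -
          obtain j where j: "1 / real (Suc j) < e" using nat_approx_posE[OF e] by blast
          have "\<exists>m\<ge>n. b pr n m \<omega> < 1 / real (Suc j)" using elim(2,3) pr by auto
          then obtain m where "m \<ge> n" "b pr n m \<omega> < 1 / real (Suc j)" by blast
          with j show ?thesis unfolding b_def by (intro exI[of _ m]) auto
        qed
      qed
      with elim(1) show ?case by blast
    qed
  qed
  \<comment> \<open>The exceptional set is described by the existence of a measure and is not
    evidently measurable; a measurable null set \<open>N\<close> around it takes its place.\<close>
  then obtain N where N: "{\<omega>\<in>space L. \<not> ((\<exists>M. ?cells \<omega> M) \<and> (\<forall>n. ?R n \<omega> \<in> Delta (fact n)))} \<subseteq> N"
    "emeasure L N = 0" "N \<in> sets L" by (rule AE_E)
  \<comment> \<open>The default is the point mass at the origin, which lies in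
    \<open>[0,1)^2\<close>, so concentration holds on \<open>N\<close> as well.\<close>
  define Mf where "Mf \<omega> = (if \<omega> \<in> space L - N then (SOME M. ?cells \<omega> M) else return Sq (0, 0))" for \<omega>
  have good: "?cells \<omega> (Mf \<omega>)" "?R n \<omega> \<in> Delta (fact n)" if \<omega>: "\<omega> \<in> space L - N" for \<omega> n
  proof -
    have ex: "\<exists>M. ?cells \<omega> M" and D: "?R n \<omega> \<in> Delta (fact n)" using N(1) \<omega> by auto
    have eq: "Mf \<omega> = (SOME M. ?cells \<omega> M)" unfolding Mf_def using \<omega> by (rule if_P)
    show "?cells \<omega> (Mf \<omega>)" unfolding eq by (rule someI_ex[OF ex])
    show "?R n \<omega> \<in> Delta (fact n)" by fact
  qed
  have bad: "Mf \<omega> = return Sq (0, 0)" if "\<omega> \<notin> space L - N" for \<omega> unfolding Mf_def using that by (rule if_not_P)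
  have pt0: "(0, 0) \<in> space Sq" by (simp add: space_Sq)
  have Mf: "Mf \<in> measurable L (prob_algebra Sq)"
  proof (rule measurable_prob_algebra_cells)
    fix \<omega> assume "\<omega> \<in> space L"
    show "Mf \<omega> \<in> space (prob_algebra Sq)"
    proof (cases "\<omega> \<in> space L - N")
      case False
      then show ?thesis using prob_space_return[OF pt0] by (simp add: bad space_prob_algebra)
    qed (use good in blast)
    show "measure (Mf \<omega>) ({0..<1} \<times> {0..<1}) = 1"
    proof (cases "\<omega> \<in> space L - N")
      case True
      have g: "grid (fact 0) = {(0, 0)}" "Ik (fact 0) 0 = {0..<1}" by (auto simp: grid_def Ik_def)
      have "measure (Mf \<omega>) (Ik (fact 0) 0 \<times> Ik (fact 0) 0) = \<omega> 0 (0, 0)"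
        using good(1)[OF True] g(1) by (metis fst_conv snd_conv singletonI)
      moreover have "\<omega> 0 (0, 0) = 1" using good(2)[OF True, of 0] unfolding Delta_def g by simp
      ultimately show ?thesis by (simp only: g)
    next
      case False
      then show ?thesis using unit_square_sets by (simp add: bad measure_return)
    qed
  next
    fix n v u :: nat assume vu: "v < fact n" "u < fact n"
    then have c: "(v, u) \<in> grid (fact n)" by (simp add: grid_def)
    have eq: "measure (Mf \<omega>) (Ik (fact n) v \<times> Ik (fact n) u) =
        (if \<omega> \<in> space L - N then \<omega> n (v, u) else measure (return Sq (0, 0)) (Ik (fact n) v \<times> Ik (fact n) u))" for \<omega>
    proof (cases "\<omega> \<in> space L - N")
      case True
      then show ?thesis using good(1)[OF True] c by (metis fst_conv snd_conv)
    next
      case False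
      then show ?thesis unfolding bad[OF False] by (subst if_not_P) auto
    qed
    have "space L - N \<in> sets L" using N(3) by auto
    then show "(\<lambda>\<omega>. measure (Mf \<omega>) (Ik (fact n) v \<times> Ik (fact n) u)) \<in> borel_measurable L"
      unfolding eq using entry[OF c] by (intro measurable_If_set) auto
  qed
  define P where "P = distr L (prob_algebra Sq) Mf"
  have "prob_space P" unfolding P_def by (rule prob_space_distr[OF Mf])
  moreover have "sets P = sets (prob_algebra Sq)" by (simp add: P_def)
  moreover have "distr P (MatSpace (fact n)) (Gk (fact n)) = \<mu> (fact n)" for n
  proof -
    have "distr P (MatSpace (fact n)) (Gk (fact n)) = distr L (MatSpace (fact n)) (Gk (fact n) \<circ> Mf)"
      unfolding P_def by (rule distr_distr[OF measurable_Gk Mf])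
    also have "\<dots> = distr L (MatSpace (fact n)) (?R n)"
    proof (rule distr_cong_AE)
      have "N \<in> null_sets L" using N by auto
      then have "AE \<omega> in L. \<omega> \<notin> N" by (rule AE_not_in)
      then show "AE \<omega> in L. (Gk (fact n) \<circ> Mf) \<omega> = ?R n \<omega>"
        using AE_space
      proof eventually_elim
        case (elim \<omega>)
        then have "?cells \<omega> (Mf \<omega>)" by (intro good) auto
        then show ?case unfolding Gk_def comp_def by (intro restrict_ext) blast
      qed
      show "Gk (fact n) \<circ> Mf \<in> measurable L (MatSpace (fact n))" by (rule measurable_comp[OF Mf measurable_Gk])
    qed (use R in auto)
    finally show ?thesis by (simp add: law)
  qed
  ultimately show ?thesis by blast
qed

theorem mainTheorem19:
  fixes \<mu> :: "nat \<Rightarrow> (nat \<times> nat \<Rightarrow> real) measure"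
  assumes "equipartition_consistent \<mu>"
  shows "\<exists>!P :: (real \<times> real) measure measure.
           prob_space P \<and> sets P = sets (prob_algebra Sq) \<and>
           exchangeable_law P \<and>
           (\<forall>k\<ge>1. distr P (MatSpace k) (Gk k) = \<mu> k)"
proof (rule ex_ex1I)
  obtain P where P: "prob_space P" "sets P = sets (prob_algebra Sq)"
    "\<And>n. distr P (MatSpace (fact n)) (Gk (fact n)) = \<mu> (fact n)"
    using exists_law_with_Gk_laws[OF assms] by blast
  then show "\<exists>P. prob_space P \<and> sets P = sets (prob_algebra Sq) \<and> exchangeable_law P \<and>
      (\<forall>k\<ge>1. distr P (MatSpace k) (Gk k) = \<mu> k)"
    using exchangeable_if_Gk_laws[OF assms P] law_of_Gk[OF assms P] by blast
next
  fix P Q :: "(real \<times> real) measure measure"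
  assume P: "prob_space P \<and> sets P = sets (prob_algebra Sq) \<and> exchangeable_law P \<and>
      (\<forall>k\<ge>1. distr P (MatSpace k) (Gk k) = \<mu> k)"
    and Q: "prob_space Q \<and> sets Q = sets (prob_algebra Sq) \<and> exchangeable_law Q \<and>
      (\<forall>k\<ge>1. distr Q (MatSpace k) (Gk k) = \<mu> k)"
  \<comment> \<open>Level 1 supplies the concentration on \<open>[0,1)^2\<close> on which the
    determination by cell masses rests.\<close>
  have "prob_on_Delta 1 (\<mu> 1)" using consistent_Delta[OF assms, of 1] by simp
  then show "P = Q"
    using P Q by (intro law_determined_by_Gk AE_concentrated) auto
qed

end
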